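(* Let $K=K_1\times\cdots\times K_n$, where each $K_j$ is a non-polar compact subset of $\mathbb C$. Let $$P(z_1,\dots,z_n)=\sum_{k_1=0}^{m_1}\cdots\sum_{k_n=0}^{m_n}a_{k_1\dots k_n}z_1^{k_1}\cdots z_n^{k_n}$$ be a non-zero polynomial with all coefficients $a_{k_1\dots k_n}\in\mathbb Z$, where $m_j\ge0$ is the degree of $P$ in $z_j$. Then $$M(P)\ \ge\ \prod_{N=1}^n\min\big(1,\mathrm{Cap}(K_N)^{m_N}\big).$$ In particular, if $\mathrm{Cap}(K_N)\ge1$ for all $N$, then $M(P)\ge1$.
   Context: $\mu_{K_j}$ is the equilibrium measure of $K_j$ and $\mathrm{Cap}$ is logarithmic capacity. The Mahler measure of $P$ relative to $K$ is $M(P)=\exp[\int\log|P|\,d\nu_K]$, where $\nu_K$ is the normalized Monge–Ampère measure of $K$; for this product set $\nu_K=\mu_{K_1}\otimes\cdots\otimes\mu_{K_n}$. *)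

theory Defs
  imports "HOL-Probability.Probability"
begin

definition prob_on :: "complex set \<Rightarrow> complex measure \<Rightarrow> bool" where
  "prob_on K \<mu> \<longleftrightarrow> prob_space \<mu> \<and> sets \<mu> = sets (borel :: complex measure)
      \<and> emeasure \<mu> (UNIV - K) = 0"

text \<open>Logarithmic energy I(mu) = double integral of log|z-w|, with value -infinity
  when it diverges.  Since the real ln satisfies ln 0 = 0 in Isabelle, we require that
  the diagonal is a null set of the product measure (otherwise the true energy is -infinity).\<close>
definition log_energy :: "complex measure \<Rightarrow> ereal" where
  "log_energy \<mu> =
     (if integrable (\<mu> \<Otimes>\<^sub>M \<mu>) (\<lambda>p. ln (cmod (fst p - snd p)))
         \<and> emeasure (\<mu> \<Otimes>\<^sub>M \<mu>) {p. fst p = snd p} = 0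
      then ereal (integral\<^sup>L (\<mu> \<Otimes>\<^sub>M \<mu>) (\<lambda>p. ln (cmod (fst p - snd p))))
      else -\<infinity>)"

definition energy_sup :: "complex set \<Rightarrow> ereal" where
  "energy_sup K = (SUP \<mu>\<in>{\<mu>. prob_on K \<mu>}. log_energy \<mu>)"

definition polar :: "complex set \<Rightarrow> bool" where
  "polar K \<longleftrightarrow> (\<forall>\<mu>. prob_on K \<mu> \<longrightarrow> log_energy \<mu> = -\<infinity>)"

definition log_cap :: "complex set \<Rightarrow> real" where
  "log_cap K = (if energy_sup K = -\<infinity> then 0 else exp (real_of_ereal (energy_sup K)))"

text \<open>Equilibrium measure: the (unique, for non-polar compact K) energy maximiser.\<close>
definition equilibrium_measure :: "complex set \<Rightarrow> complex measure" where
  "equilibrium_measure K = (THE \<mu>. prob_on K \<mu> \<and> log_energy \<mu> = energy_sup K)"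

definition mpoly_idx :: "nat \<Rightarrow> (nat \<Rightarrow> nat) \<Rightarrow> (nat \<Rightarrow> nat) set" where
  "mpoly_idx n m = PiE {..<n} (\<lambda>j. {..m j})"

definition mpoly_eval :: "nat \<Rightarrow> (nat \<Rightarrow> nat) \<Rightarrow> ((nat \<Rightarrow> nat) \<Rightarrow> int) \<Rightarrow> (nat \<Rightarrow> complex) \<Rightarrow> complex" where
  "mpoly_eval n m a z = (\<Sum>k\<in>mpoly_idx n m. of_int (a k) * (\<Prod>j<n. z j ^ k j))"

text \<open>Normalized Monge-Ampere measure of the product set: product of equilibrium measures.\<close>
definition product_eq_measure :: "nat \<Rightarrow> (nat \<Rightarrow> complex set) \<Rightarrow> (nat \<Rightarrow> complex) measure" where
  "product_eq_measure n K = PiM {..<n} (\<lambda>j. equilibrium_measure (K j))"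

definition mahler_measure :: "nat \<Rightarrow> (nat \<Rightarrow> complex set) \<Rightarrow> (nat \<Rightarrow> nat) \<Rightarrow> ((nat \<Rightarrow> nat) \<Rightarrow> int) \<Rightarrow> real" where
  "mahler_measure n K m a =
     exp (integral\<^sup>L (product_eq_measure n K) (\<lambda>z. ln (cmod (mpoly_eval n m a z))))"

end

theory Submission
  imports Defs "HOL-Computational_Algebra.Fundamental_Theorem_Algebra"
begin

text \<open>
  By Frostman's theorem the equilibrium measure \<open>\<mu>\<close> of a non-polar compact \<open>K\<close> has potential at least
  \<open>ln Cap(K)\<close> at every point of the plane.  Factoring \<open>P\<close> in its last variable therefore bounds the
  integral of \<open>ln |P|\<close> over that variable from below by \<open>ln |Q| + d ln Cap(K)\<close>, where \<open>d\<close> is the degree in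
  that variable and \<open>Q\<close> the leading coefficient, again an integer polynomial; induction on the number of
  variables ends with a non-zero integer.

  The equilibrium measure exists because the energy is lower semicontinuous under weak limits, and is
  unique because \<open>- ln |z - w|\<close> is, up to a constant, a mixture of the strictly positive definite kernels
  \<open>exp (- t |z - w|\<^sup>2)\<close>.
\<close>

section \<open>Weak compactness of probability measures on a compact planar set\<close>

text \<open>The logarithm is unbounded and has both signs, so energies are handled through ln(D / |z
  - w|), where K lies in the disc of radius D / 2. This kernel is nonnegative on K, its integrals
  live in \<open>ennreal\<close> without integrability conditions, and maximising
  \<open>log_energy\<close> becomes minimising \<open>mutual_energy D\<close>, since a finite energy
  is ln D minus the mutual energy.

  The potential must be bounded below on the whole plane and not only on K, because the roots of P
  in its last variable wander with the other variables. The variational argument gives the bound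
  only \<mu>-almost everywhere; lower semicontinuity of \<open>log_pot\<close> turns this into a
  bound on a compact carrier, and a minimum principle extends it to the plane.

  The minimum with 1 comes from the induction: a leading coefficient may have lower degree in the
  remaining variables than P has, so the argument produces d_N ln Cap(K_N) for some 0 \<le> d_N
  \<le> m_N, and min(0, m_N ln Cap(K_N)) is a lower bound for all of these.\<close>

text \<open>A continuous function that reads off the first digit (halved) of a point of the Cantor set; it and
  \<open>tern_shift\<close> make decoding a real into a pair of binary expansions continuous on the whole line.\<close>
definition tern_digit :: "real \<Rightarrow> real" where
  "tern_digit x = max 0 (min 1 (3 * x - 1))"

definition tern_shift :: "real \<Rightarrow> real" where
  "tern_shift x = 3 * x - 2 * tern_digit x"

text \<open>The point of the Cantor set with ternary digits \<open>2 * b k\<close>. Avoiding the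
  digit 1 leaves a gap between the two halves, across which a continuous function can tell the
  digits apart.\<close>

definition cantor_code :: "(nat \<Rightarrow> real) \<Rightarrow> real" where
  "cantor_code b = (\<Sum>k. 2 * b k / 3 ^ Suc k)"

definition bin_digit :: "nat \<Rightarrow> real \<Rightarrow> real" where
  "bin_digit k x = real_of_int (\<lfloor>2 ^ Suc k * x\<rfloor> - 2 * \<lfloor>2 ^ k * x\<rfloor>)"

lemma cantor_code_summable:
  fixes b :: "nat \<Rightarrow> real"
  assumes "\<And>k. b k \<in> {0, 1}"
  shows "summable (\<lambda>k. 2 * b k / 3 ^ Suc k)"
proof (rule summable_comparison_test')
  show "summable (\<lambda>k. 2 / 3 * (1/3::real) ^ k)"
    by (intro summable_mult summable_geometric) simp
  show "norm (2 * b k / 3 ^ Suc k) \<le> 2 / 3 * (1/3) ^ k" if "k \<ge> 0" for k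
    using assms[of k] by (auto simp: field_simps)
qed

lemma cantor_code_bounds:
  assumes "\<And>k. b k \<in> {0, 1}"
  shows "0 \<le> cantor_code b" "cantor_code b \<le> 1"
proof -
  note s = cantor_code_summable[of b, OF assms]
  show "0 \<le> cantor_code b" unfolding cantor_code_def
  proof (rule suminf_nonneg[OF s])
    show "0 \<le> 2 * b k / 3 ^ Suc k" for k using assms[of k] by auto
  qed
  have g: "(\<lambda>k. 2 / 3 * (1/3::real) ^ k) sums (2 / 3 * (1 / (1 - 1/3)))"
    by (intro sums_mult geometric_sums) simp
  have "cantor_code b \<le> (\<Sum>k. 2 / 3 * (1/3::real) ^ k)" unfolding cantor_code_def
  proof (rule suminf_le[OF _ s sums_summable[OF g]])
    show "2 * b k / 3 ^ Suc k \<le> 2 / 3 * (1/3) ^ k" for k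
      using assms[of k] by (auto simp: field_simps)
  qed
  then show "cantor_code b \<le> 1" using sums_unique[OF g] by simp
qed

lemma cantor_code_unfold:
  assumes "\<And>k. b k \<in> {0, 1}"
  shows "3 * cantor_code b = 2 * b 0 + cantor_code (\<lambda>k. b (Suc k))"
proof -
  note s = cantor_code_summable[of b, OF assms]
  have s': "summable (\<lambda>k. 2 * b (Suc k) / 3 ^ Suc k)"
    by (rule cantor_code_summable) (use assms in auto)
  have "cantor_code b = 2 * b 0 / 3 + (\<Sum>k. 2 * b (Suc k) / 3 ^ Suc (Suc k))"
    using suminf_split_head[OF s] by (simp add: cantor_code_def)
  also have "(\<Sum>k. 2 * b (Suc k) / 3 ^ Suc (Suc k)) = (\<Sum>k. (1/3) * (2 * b (Suc k) / 3 ^ Suc k))"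
    by (intro arg_cong[where f=suminf]) auto
  also have "\<dots> = (1/3) * cantor_code (\<lambda>k. b (Suc k))"
    unfolding cantor_code_def by (rule suminf_mult[OF s'])
  finally show ?thesis by simp
qed

text \<open>The tail of the code lies in [0, 1], so three times the code lies in [0, 1] or in
  [2, 3], where the clipping in \<open>tern_digit\<close> returns exactly 0 or 1.\<close>

lemma tern_digit_code:
  assumes "\<And>k. b k \<in> {0, 1}"
  shows "tern_digit (cantor_code b) = b 0"
    and "tern_shift (cantor_code b) = cantor_code (\<lambda>k. b (Suc k))"
proof -
  have "0 \<le> cantor_code (\<lambda>k. b (Suc k))" "cantor_code (\<lambda>k. b (Suc k)) \<le> 1"
    using cantor_code_bounds[of "\<lambda>k. b (Suc k)"] assms by auto
  then show 1: "tern_digit (cantor_code b) = b 0"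
    using assms[of 0] cantor_code_unfold[of b, OF assms] unfolding tern_digit_def by auto
  show "tern_shift (cantor_code b) = cantor_code (\<lambda>k. b (Suc k))"
    using 1 cantor_code_unfold[of b, OF assms] by (simp add: tern_shift_def)
qed

lemma tern_digit_shift_code:
  assumes "\<And>k. b k \<in> {0, 1}"
  shows "tern_digit ((tern_shift ^^ k) (cantor_code b)) = b k"
proof -
  have "(tern_shift ^^ k) (cantor_code b) = cantor_code (\<lambda>i. b (i + k))"
  proof (induction k)
    case (Suc k)
    then show ?case using tern_digit_code(2)[of "\<lambda>i. b (i + k)"] assms by simp
  qed simp
  then show ?thesis using tern_digit_code(1)[of "\<lambda>i. b (i + k)"] assms by simp
qed

lemma continuous_tern_shift_pow: "continuous_on UNIV (tern_shift ^^ k)"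
proof (induction k)
  case (Suc k)
  have "continuous_on UNIV tern_shift"
    unfolding tern_shift_def tern_digit_def by (intro continuous_intros)
  from continuous_on_compose2[OF this Suc] show ?case by (simp add: o_def)
qed (simp add: id_def)

text \<open>Clipping keeps \<open>tern_digit\<close> in [0, 1] off the Cantor set too, so the M-test
  applies on the whole line. The map \<open>f\<close> selects which digits are read.\<close>

lemma continuous_digit_series:
  "continuous_on UNIV (\<lambda>x. \<Sum>k. tern_digit ((tern_shift ^^ (f k)) x) / 2 ^ Suc k)"
proof -
  have "uniform_limit UNIV (\<lambda>n x. \<Sum>k<n. tern_digit ((tern_shift ^^ (f k)) x) / 2 ^ Suc k)
      (\<lambda>x. \<Sum>k. tern_digit ((tern_shift ^^ (f k)) x) / 2 ^ Suc k) sequentially"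
  proof (rule Weierstrass_m_test)
    show "norm (tern_digit ((tern_shift ^^ f n) x) / 2 ^ Suc n) \<le> (1/2) ^ n" for n x
      by (auto simp: tern_digit_def field_simps abs_if max_def min_def)
  qed (auto intro: summable_geometric)
  moreover have "continuous_on UNIV (\<lambda>x. \<Sum>k<n. tern_digit ((tern_shift ^^ (f k)) x) / 2 ^ Suc k)" for n
    unfolding tern_digit_def
    by (intro continuous_intros continuous_tern_shift_pow) auto
  ultimately show ?thesis
    by (intro uniform_limit_theorem[where F=sequentially]) auto
qed

lemma bin_digit_01: "bin_digit k x \<in> {0, 1}"
proof -
  have "\<lfloor>2 ^ Suc k * x\<rfloor> - 2 * \<lfloor>2 ^ k * x\<rfloor> \<in> {0, 1}"
    by (simp add: mult.assoc) linarith
  then show ?thesis by (auto simp: bin_digit_def)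
qed

text \<open>The partial sums telescope to floor(2^n x) / 2^n; the telescoping starts at floor(x) =
  0.\<close>

lemma bin_digit_sums:
  assumes "0 \<le> x" "x < 1"
  shows "(\<lambda>k. bin_digit k x / 2 ^ Suc k) sums x"
proof -
  have e: "(\<Sum>k<n. bin_digit k x / 2 ^ Suc k) = real_of_int \<lfloor>2 ^ n * x\<rfloor> / 2 ^ n" for n
  proof (induction n)
    case 0
    then show ?case using assms by simp linarith
  qed (simp add: bin_digit_def field_simps)
  have "(\<lambda>n. real_of_int \<lfloor>2 ^ n * x\<rfloor> / 2 ^ n) \<longlonglongrightarrow> x"
  proof (rule tendsto_sandwich[where f="\<lambda>n. x - (1/2) ^ n" and h="\<lambda>_. x"])
    have "x - (1/2) ^ n \<le> real_of_int \<lfloor>2 ^ n * x\<rfloor> / 2 ^ n" for n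
    proof -
      have "x - (1/2) ^ n = (2 ^ n * x - 1) / 2 ^ n"
        by (simp add: power_divide diff_divide_distrib)
      also have "\<dots> \<le> real_of_int \<lfloor>2 ^ n * x\<rfloor> / 2 ^ n"
        by (rule divide_right_mono) (linarith, simp)
      finally show ?thesis .
    qed
    then show "\<forall>\<^sub>F n in sequentially. x - (1/2) ^ n \<le> real_of_int \<lfloor>2 ^ n * x\<rfloor> / 2 ^ n"
      by simp
    have "real_of_int \<lfloor>2 ^ n * x\<rfloor> \<le> 2 ^ n * x" for n by linarith
    then show "\<forall>\<^sub>F n in sequentially. real_of_int \<lfloor>2 ^ n * x\<rfloor> / 2 ^ n \<le> x"
      by (auto simp: field_simps)
    have "(\<lambda>n. x - (1/2) ^ n) \<longlonglongrightarrow> x - 0"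
      by (intro tendsto_intros LIMSEQ_power_zero) auto
    then show "(\<lambda>n. x - (1/2) ^ n) \<longlonglongrightarrow> x" by simp
  qed simp
  then show ?thesis unfolding sums_def e .
qed

text \<open>A form of the Hausdorff-Alexandroff theorem: \<open>s\<close> interleaves the binary
  digits of the two rescaled coordinates and \<open>c\<close> separates them again. Only the decoder
  \<open>c\<close> has to be continuous; limits are taken on the line and then pushed forward by
  \<open>c\<close>, so a Borel encoder is enough.\<close>

lemma continuous_decoding:
  fixes R :: real
  obtains c :: "real \<Rightarrow> complex" and s :: "complex \<Rightarrow> real"
  where "continuous_on UNIV c" "s \<in> borel_measurable borel" "\<And>z. s z \<in> {0..1}"
    "\<And>z. cmod z \<le> R \<Longrightarrow> c (s z) = z"
proof -
  \<comment> \<open>With this T, both coordinates of a point of the disc are strictly below T / 2 in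
    modulus, so x / T + 1/2 falls in [0, 1), the range of \<open>bin_digit_sums\<close>. The
    absolute value keeps T positive for every R.\<close>
  define T where "T = 2 * (\<bar>R\<bar> + 1)"
  have T: "T > 0" by (simp add: T_def add_nonneg_pos)
  define dg where "dg z k = (if even k then bin_digit (k div 2) (Re z / T + 1/2)
      else bin_digit (k div 2) (Im z / T + 1/2))" for z k
  define s where "s z = cantor_code (dg z)" for z
  define d where "d j x = (\<Sum>k. tern_digit ((tern_shift ^^ (2 * k + j)) x) / 2 ^ Suc k)" for j x
  define c where "c x = Complex (T * (d 0 x - 1/2)) (T * (d 1 x - 1/2))" for x
  have dg: "dg z k \<in> {0, 1}" for z k
    unfolding dg_def using bin_digit_01 by auto
  show ?thesis
  proof
    have "continuous_on UNIV (d j)" for j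
      unfolding d_def using continuous_digit_series .
    then show "continuous_on UNIV c"
      unfolding c_def Complex_eq by (intro continuous_intros)
    have "(\<lambda>z. dg z k) \<in> borel_measurable borel" for k
      unfolding dg_def bin_digit_def by (cases "even k") simp_all
    then show "s \<in> borel_measurable borel"
      unfolding s_def cantor_code_def by measurable
    show "s z \<in> {0..1}" for z
      using cantor_code_bounds[of "dg z"] dg by (auto simp: s_def)
    show "c (s z) = z" if "cmod z \<le> R" for z
    proof -
      have "\<bar>Re z\<bar> < T / 2" "\<bar>Im z\<bar> < T / 2"
        using that abs_Re_le_cmod[of z] abs_Im_le_cmod[of z] by (auto simp: T_def)
      then have b: "0 \<le> Re z / T + 1/2" "Re z / T + 1/2 < 1" "0 \<le> Im z / T + 1/2" "Im z / T + 1/2 < 1"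
        using T by (auto simp: field_simps abs_less_iff)
      have "d 0 (s z) = Re z / T + 1/2" "d 1 (s z) = Im z / T + 1/2"
        using sums_unique[OF bin_digit_sums[OF b(1,2)]] sums_unique[OF bin_digit_sums[OF b(3,4)]]
        unfolding d_def s_def tern_digit_shift_code[of "dg z", OF dg] by (auto simp: dg_def)
      then show ?thesis using T by (simp add: c_def complex_eq_iff)
    qed
  qed
qed

section \<open>Measures carried by K and extraction of convergent subsequences\<close>

lemma prob_on_AE: "prob_on K \<mu> \<Longrightarrow> closed K \<Longrightarrow> AE z in \<mu>. z \<in> K"
  by (rule AE_I[where N="UNIV - K"])
    (auto simp: prob_on_def intro: borel_closed sets.Diff)

lemma prob_onI:
  assumes "prob_space \<mu>" "sets \<mu> = sets borel" "closed K" "AE z in \<mu>. z \<in> K"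
  shows "prob_on K \<mu>"
proof -
  have sp: "space \<mu> = UNIV" using sets_eq_imp_space_eq[OF assms(2)] by simp
  have "UNIV - K \<in> sets \<mu>" using assms by (simp add: borel_closed)
  then have "emeasure \<mu> (UNIV - K) = 0"
    using assms(4) AE_iff_measurable[of "UNIV - K" \<mu> "\<lambda>z. z \<in> K"] by (auto simp: sp)
  then show ?thesis using assms by (simp add: prob_on_def)
qed

text \<open>Through the coding, Helly selection and Skorohod representation on the line yield weak compactness
  in the plane, with the limit realised pointwise.\<close>
lemma prob_on_subsequence:
  assumes K: "compact K" and \<mu>: "\<And>n. prob_on K (\<mu> n)"
  obtains r :: "nat \<Rightarrow> nat" and \<Omega> :: "real measure" and X :: "nat \<Rightarrow> real \<Rightarrow> complex" and Y
  where "strict_mono r" "prob_space \<Omega>" "\<And>n. X n \<in> borel_measurable \<Omega>"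
    "\<And>n. distr \<Omega> borel (X n) = \<mu> (r n)" "Y \<in> borel_measurable \<Omega>"
    "\<And>\<omega>. \<omega> \<in> space \<Omega> \<Longrightarrow> (\<lambda>n. X n \<omega>) \<longlonglongrightarrow> Y \<omega>" "prob_on K (distr \<Omega> borel Y)"
proof -
  obtain R where R: "\<And>z. z \<in> K \<Longrightarrow> cmod z \<le> R"
    using compact_imp_bounded[OF K] by (auto simp: bounded_iff)
  obtain c :: "real \<Rightarrow> complex" and s where cs: "continuous_on UNIV c" "s \<in> borel_measurable borel"
    "\<And>z. s z \<in> {0..1}" "\<And>z. cmod z \<le> R \<Longrightarrow> c (s z) = z"
    using continuous_decoding[of R] by blast
  have c[measurable]: "c \<in> borel_measurable borel"
    using cs(1) by (rule borel_measurable_continuous_onI)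
  have sets: "sets (\<mu> n) = sets borel" and ps: "prob_space (\<mu> n)" for n
    using \<mu>[of n] by (auto simp: prob_on_def)
  note sets[measurable_cong] note cs(2)[measurable]
  define \<nu> where "\<nu> n = distr (\<mu> n) borel s" for n
  have \<nu>: "real_distribution (\<nu> n)" for n
    unfolding \<nu>_def real_distribution_def real_distribution_axioms_def
    using prob_space.prob_space_distr[OF ps, of s _ borel] by simp
  \<comment> \<open>Tightness is phrased with half-open intervals, hence a left end strictly below
    the possible code 0.\<close>
  have "measure (\<nu> n) {-1<..1} = 1" for n
  proof -
    have "-1 < s z" "s z \<le> 1" for z using cs(3)[of z] by auto
    then have "s -` {-1<..1} = UNIV" by auto
    then have "measure (\<nu> n) {-1<..1} = measure (\<mu> n) (space (\<mu> n))"
      unfolding \<nu>_def by (subst measure_distr) auto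
    also have "\<dots> = 1" by (rule prob_space.prob_space[OF ps])
    finally show ?thesis .
  qed
  then have "tight \<nu>" unfolding tight_def using \<nu>
    by (intro conjI allI impI exI[where x="-1::real"] exI[where x="1::real"]) auto
  then obtain r M where r: "strict_mono r" "real_distribution M" "weak_conv_m (\<nu> \<circ> id \<circ> r) M"
    using tight_imp_convergent_subsubsequence[of \<nu> id] by (auto simp: strict_mono_def)
  obtain \<Omega> :: "real measure" and Ys Y where Y: "prob_space \<Omega>"
    "\<And>n. Ys n \<in> measurable \<Omega> borel" "\<And>n. distr \<Omega> borel (Ys n) = \<nu> (r n)"
    "Y \<in> measurable \<Omega> lborel" "\<And>x. x \<in> space \<Omega> \<Longrightarrow> (\<lambda>n. Ys n x) \<longlonglongrightarrow> Y x"
    using Skorohod[of "\<nu> \<circ> id \<circ> r" M] \<nu> r unfolding o_def id_def by blast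
  note Y(2)[measurable]
  have [measurable]: "Y \<in> measurable \<Omega> borel" using Y(4) by simp
  show ?thesis
  proof
    show "strict_mono r" "prob_space \<Omega>" by fact+
    show X[measurable]: "(\<lambda>\<omega>. c (Ys n \<omega>)) \<in> borel_measurable \<Omega>" for n by measurable
    show Y'[measurable]: "(\<lambda>\<omega>. c (Y \<omega>)) \<in> borel_measurable \<Omega>" by measurable
    \<comment> \<open>Decoding undoes coding on K, which carries all the mass, so variables
      distributed like the codes decode to variables with law \<open>\<mu> (r n)\<close>.\<close>
    show d: "distr \<Omega> borel (\<lambda>\<omega>. c (Ys n \<omega>)) = \<mu> (r n)" for n
    proof -
      have "distr \<Omega> borel (\<lambda>\<omega>. c (Ys n \<omega>)) = distr (distr \<Omega> borel (Ys n)) borel c"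
        by (subst distr_distr) (auto simp: o_def)
      also have "\<dots> = distr (\<mu> (r n)) borel (\<lambda>z. c (s z))"
        by (simp add: Y(3) \<nu>_def) (subst distr_distr, auto simp: o_def)
      also have "\<dots> = distr (\<mu> (r n)) borel (\<lambda>z. z)"
      proof (rule distr_cong_AE)
        show "AE z in \<mu> (r n). c (s z) = z"
          using prob_on_AE[OF \<mu> compact_imp_closed[OF K], of "r n"] cs(4) R by auto
      qed (auto simp: sets)
      also have "\<dots> = \<mu> (r n)" by (rule distr_id2) (simp add: sets)
      finally show ?thesis .
    qed
    show conv: "(\<lambda>n. c (Ys n \<omega>)) \<longlonglongrightarrow> c (Y \<omega>)" if "\<omega> \<in> space \<Omega>" for \<omega>
      by (rule continuous_on_tendsto_compose[OF cs(1) Y(5)[OF that]]) auto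
    have "AE \<omega> in \<Omega>. c (Ys n \<omega>) \<in> K" for n
      using prob_on_AE[OF \<mu> compact_imp_closed[OF K], of "r n"] 
      unfolding d[symmetric] by (subst (asm) AE_distr_iff) (auto simp: compact_imp_closed[OF K] borel_closed)
    then have "AE \<omega> in \<Omega>. \<forall>n. c (Ys n \<omega>) \<in> K" by (simp add: AE_all_countable)
    then have "AE \<omega> in \<Omega>. c (Y \<omega>) \<in> K"
      using AE_space
    proof eventually_elim
      case (elim \<omega>)
      then show ?case
        using closed_sequentially[OF compact_imp_closed[OF K], of "\<lambda>n. c (Ys n \<omega>)"] conv by auto
    qed
    then have "AE z in distr \<Omega> borel (\<lambda>\<omega>. c (Y \<omega>)). z \<in> K"
      by (subst AE_distr_iff) (auto simp: compact_imp_closed[OF K] borel_closed)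
    then show "prob_on K (distr \<Omega> borel (\<lambda>\<omega>. c (Y \<omega>)))"
      using prob_space.prob_space_distr[OF Y(1) Y'] compact_imp_closed[OF K]
      by (intro prob_onI) auto
  qed
qed

section \<open>Logarithmic energy and its minimisers\<close>

text \<open>Useful only for points at distance at most \<open>D\<close>: beyond that \<open>ennreal\<close> truncates to \<open>0\<close>.\<close>
definition log_kernel :: "real \<Rightarrow> complex \<Rightarrow> complex \<Rightarrow> ennreal" where
  "log_kernel D z w = (if z = w then \<infinity> else ennreal (ln (D / cmod (z - w))))"

text \<open>When the mass of \<open>\<mu>\<close> lies within distance D of z, this is ln D minus
  the logarithmic potential at z: upper bounds here are lower bounds for the potential.\<close>

definition log_pot :: "real \<Rightarrow> complex measure \<Rightarrow> complex \<Rightarrow> ennreal" where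
  "log_pot D \<mu> z = (\<integral>\<^sup>+ w. log_kernel D z w \<partial>\<mu>)"

definition mutual_energy :: "real \<Rightarrow> complex measure \<Rightarrow> complex measure \<Rightarrow> ennreal" where
  "mutual_energy D \<mu> \<nu> = (\<integral>\<^sup>+ z. log_pot D \<nu> z \<partial>\<mu>)"

lemma log_kernel_commute: "log_kernel D z w = log_kernel D w z"
  by (auto simp: log_kernel_def norm_minus_commute)

lemma measurable_log_kernel [measurable (raw)]:
  assumes [measurable]: "f \<in> borel_measurable M" "g \<in> borel_measurable M"
  shows "(\<lambda>x. log_kernel D (f x) (g x)) \<in> borel_measurable M"
  unfolding log_kernel_def by measurable

lemma measurable_log_pot:
  assumes "prob_space \<mu>" "sets \<mu> = sets borel"
  shows "log_pot D \<mu> \<in> borel_measurable borel"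
proof -
  interpret prob_space \<mu> by fact
  note assms(2)[measurable_cong]
  show ?thesis unfolding log_pot_def by measurable
qed

text \<open>The kernel is even continuous as a map into [0, \<infinity>]: it exceeds c as soon as
  the distance drops below D exp(-c). The liminf form is what Fatou's lemma consumes.\<close>

lemma log_kernel_liminf:
  assumes D: "D > 0" and x: "x \<longlonglongrightarrow> z" and y: "y \<longlonglongrightarrow> w"
  shows "log_kernel D z w \<le> liminf (\<lambda>n. log_kernel D (x n) (y n))"
proof -
  have d: "(\<lambda>n. x n - y n) \<longlonglongrightarrow> z - w" by (intro tendsto_intros x y)
  have "(\<lambda>n. log_kernel D (x n) (y n)) \<longlonglongrightarrow> log_kernel D z w"
  proof (cases "z = w")
    case False
    then have "\<forall>\<^sub>F n in sequentially. x n - y n \<noteq> 0"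
      using d by (intro tendsto_imp_eventually_ne) auto
    then have "\<forall>\<^sub>F n in sequentially. ennreal (ln (D / cmod (x n - y n))) = log_kernel D (x n) (y n)"
      by eventually_elim (auto simp: log_kernel_def)
    moreover have "(\<lambda>n. ennreal (ln (D / cmod (x n - y n)))) \<longlonglongrightarrow> ennreal (ln (D / cmod (z - w)))"
      using False D by (intro tendsto_ennrealI tendsto_intros d) auto
    ultimately have "(\<lambda>n. log_kernel D (x n) (y n)) \<longlonglongrightarrow> ennreal (ln (D / cmod (z - w)))"
      by (rule Lim_transform_eventually[rotated])
    then show ?thesis using False by (simp add: log_kernel_def)
  next
    case True
    have "(\<lambda>n. log_kernel D (x n) (y n)) \<longlonglongrightarrow> top"
      unfolding tendsto_top_iff_ennreal
    proof (intro allI impI)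
      fix c :: real assume "c \<ge> 0"
      have "\<forall>\<^sub>F n in sequentially. cmod (x n - y n) < D * exp (- c)"
        using tendsto_norm[OF d] True D by (intro order_tendstoD) auto
      then show "\<forall>\<^sub>F n in sequentially. ennreal c < log_kernel D (x n) (y n)"
      proof eventually_elim
        fix n assume *: "cmod (x n - y n) < D * exp (- c)"
        show "ennreal c < log_kernel D (x n) (y n)"
        proof (cases "x n = y n")
          case False
          then have "exp c < D / cmod (x n - y n)"
            using * by (simp add: field_simps exp_minus)
          then have "c < ln (D / cmod (x n - y n))"
            using False D by (subst ln_exp[symmetric], subst ln_less_cancel_iff) auto
          then show ?thesis using False \<open>c \<ge> 0\<close> by (simp add: log_kernel_def ennreal_less_iff)
        qed (simp add: log_kernel_def)
      qed
    qed
    then show ?thesis using True by (simp add: log_kernel_def)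
  qed
  then show ?thesis by (simp add: lim_imp_Liminf)
qed

text \<open>Fatou's lemma. Its purpose is to make the sublevel sets of the potential closed.\<close>

lemma log_pot_liminf:
  assumes D: "D > 0" and \<mu>: "sets \<mu> = sets borel" and x: "x \<longlonglongrightarrow> z"
  shows "log_pot D \<mu> z \<le> liminf (\<lambda>n. log_pot D \<mu> (x n))"
proof -
  note \<mu>[measurable_cong]
  have "log_pot D \<mu> z \<le> (\<integral>\<^sup>+ w. liminf (\<lambda>n. log_kernel D (x n) w) \<partial>\<mu>)"
    unfolding log_pot_def by (intro nn_integral_mono log_kernel_liminf D x tendsto_const)
  also have "\<dots> \<le> liminf (\<lambda>n. log_pot D \<mu> (x n))"
    unfolding log_pot_def by (intro nn_integral_liminf) measurable
  finally show ?thesis .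
qed

lemma mutual_energy_commute:
  assumes "prob_space \<mu>" "sets \<mu> = sets borel" "prob_space \<nu>" "sets \<nu> = sets borel"
  shows "mutual_energy D \<mu> \<nu> = mutual_energy D \<nu> \<mu>"
proof -
  note assms(2,4)[measurable_cong]
  interpret \<mu>: prob_space \<mu> by fact
  interpret \<nu>: prob_space \<nu> by fact
  interpret pair_sigma_finite \<mu> \<nu> ..
  have "mutual_energy D \<mu> \<nu> = (\<integral>\<^sup>+ w. \<integral>\<^sup>+ z. log_kernel D z w \<partial>\<mu> \<partial>\<nu>)"
    unfolding mutual_energy_def log_pot_def by (rule Fubini'[symmetric]) measurable
  then show ?thesis by (simp add: mutual_energy_def log_pot_def log_kernel_commute)
qed

text \<open>The kernel is infinite on the diagonal, so finiteness of \<open>mutual_energy\<close>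
  encodes both conditions in \<open>log_energy\<close>, the null diagonal and integrability. Off the
  diagonal it is ln D - ln |z - w|, nonnegative on K because K has diameter at most D.\<close>

lemma log_energy_eq:
  assumes \<mu>: "prob_on K \<mu>" and K: "closed K" "\<And>z. z \<in> K \<Longrightarrow> cmod z \<le> D / 2" and D: "D > 0"
  shows "log_energy \<mu> = (if mutual_energy D \<mu> \<mu> = \<infinity> then -\<infinity>
      else ereal (ln D - enn2real (mutual_energy D \<mu> \<mu>)))"
proof -
  have ps: "prob_space \<mu>" and sets[measurable_cong]: "sets \<mu> = sets borel"
    using \<mu> by (auto simp: prob_on_def)
  interpret prob_space \<mu> by fact
  interpret P: pair_prob_space \<mu> \<mu> ..
  let ?P = "\<mu> \<Otimes>\<^sub>M \<mu>"
  let ?f = "\<lambda>p. ln (cmod (fst p - snd p))"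
  have E: "mutual_energy D \<mu> \<mu> = (\<integral>\<^sup>+ p. log_kernel D (fst p) (snd p) \<partial>?P)"
    unfolding mutual_energy_def log_pot_def by (subst nn_integral_fst[symmetric]) auto
  have sp: "space ?P = UNIV"
    using sets_eq_imp_space_eq[OF sets] by (simp add: space_pair_measure)
  have diag[measurable]: "{p. fst p = snd p} \<in> sets ?P"
  proof -
    have "{p \<in> space ?P. fst p = snd p} \<in> sets ?P" by measurable
    then show ?thesis by (simp add: sp)
  qed
  have A: "AE z in \<mu>. z \<in> K" using prob_on_AE[OF \<mu> K(1)] .
  have AE: "AE p in ?P. cmod (fst p - snd p) \<le> D"
  proof (rule P.AE_pair_measure)
    show "{x \<in> space ?P. cmod (fst x - snd x) \<le> D} \<in> sets ?P" by measurable
    have d: "cmod (z - w) \<le> D" if "z \<in> K" "w \<in> K" for z w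
      using K(2)[OF that(1)] K(2)[OF that(2)] norm_triangle_ineq4[of z w] by linarith
    show "AE x in \<mu>. AE y in \<mu>. cmod (fst (x, y) - snd (x, y)) \<le> D"
      using A
    proof eventually_elim
      case (elim x)
      from A show ?case by eventually_elim (simp add: d elim)
    qed
  qed
  show ?thesis
  proof (cases "mutual_energy D \<mu> \<mu> = \<infinity>")
    case True
    have "\<not> (integrable ?P ?f \<and> emeasure ?P {p. fst p = snd p} = 0)"
    proof
      assume *: "integrable ?P ?f \<and> emeasure ?P {p. fst p = snd p} = 0"
      then have N: "AE p in ?P. fst p \<noteq> snd p"
        by (intro AE_I[where N="{p. fst p = snd p}"]) auto
      have "mutual_energy D \<mu> \<mu> = (\<integral>\<^sup>+ p. ennreal (ln D - ?f p) \<partial>?P)"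
        unfolding E by (rule nn_integral_cong_AE)
          (use N D in \<open>auto elim!: eventually_mono simp: log_kernel_def ln_div\<close>)
      also have "\<dots> \<le> (\<integral>\<^sup>+ p. ennreal (norm (ln D - ?f p)) \<partial>?P)"
        by (intro nn_integral_mono ennreal_leI) auto
      also have "\<dots> < \<infinity>"
        using * integrable_iff_bounded[of ?P "\<lambda>p. ln D - ?f p"] by auto
      finally show False using True by simp
    qed
    then show ?thesis using True by (auto simp: log_energy_def)
  next
    case False
    then have fin: "(\<integral>\<^sup>+ p. log_kernel D (fst p) (snd p) \<partial>?P) \<noteq> \<infinity>" using E by simp
    have N: "AE p in ?P. fst p \<noteq> snd p"
      using nn_integral_noteq_infinite[OF _ fin] by (auto simp: log_kernel_def elim!: eventually_mono)
    then have N0: "emeasure ?P {p. fst p = snd p} = 0"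
      using AE_iff_measurable[OF diag, of "\<lambda>p. fst p \<noteq> snd p"] by (simp add: sp)
    have pos: "AE p in ?P. 0 \<le> ln D - ?f p"
      using N AE by eventually_elim (use D in simp)
    have e: "(\<integral>\<^sup>+ p. ennreal (ln D - ?f p) \<partial>?P) = mutual_energy D \<mu> \<mu>"
      unfolding E by (rule nn_integral_cong_AE)
        (use N D in \<open>auto elim!: eventually_mono simp: log_kernel_def ln_div\<close>)
    have int: "integrable ?P (\<lambda>p. ln D - ?f p)"
      using pos e False by (intro integrableI_nonneg) (auto simp: less_top)
    have "integrable ?P (\<lambda>p. ln D - (ln D - ?f p))"
      by (intro Bochner_Integration.integrable_diff int) simp
    then have int': "integrable ?P ?f" by simp
    have "ennreal (\<integral>p. (ln D - ?f p) \<partial>?P) = mutual_energy D \<mu> \<mu>"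
      using nn_integral_eq_integral[OF int pos] e by simp
    moreover have "(\<integral>p. (ln D - ?f p) \<partial>?P) \<ge> 0" using pos by (rule integral_nonneg_AE)
    ultimately have "enn2real (mutual_energy D \<mu> \<mu>) = (\<integral>p. (ln D - ?f p) \<partial>?P)"
      by (metis enn2real_ennreal)
    also have "\<dots> = ln D - (\<integral>p. ?f p \<partial>?P)"
      using int' P.prob_space by (subst Bochner_Integration.integral_diff) auto
    finally show ?thesis using False N0 int' by (simp add: log_energy_def)
  qed
qed

definition energy_minimiser :: "real \<Rightarrow> complex set \<Rightarrow> complex measure \<Rightarrow> bool" where
  "energy_minimiser D K \<mu> \<longleftrightarrow> prob_on K \<mu> \<and> mutual_energy D \<mu> \<mu> < \<infinity> \<and>
     (\<forall>\<nu>. prob_on K \<nu> \<longrightarrow> mutual_energy D \<mu> \<mu> \<le> mutual_energy D \<nu> \<nu>)"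

text \<open>The direct method. Along a minimising sequence the weak limit is realised by pointwise
  convergent random variables, so lower semicontinuity of the double integral is Fatou's lemma
  applied to the inner and then to the outer integral.\<close>

lemma energy_minimiser_exists:
  assumes K: "compact K" and D: "D > 0" and fin: "prob_on K \<nu>" "mutual_energy D \<nu> \<nu> < \<infinity>"
  shows "\<exists>\<mu>. energy_minimiser D K \<mu>"
proof -
  define A where "A = (\<lambda>\<mu>. mutual_energy D \<mu> \<mu>) ` {\<mu>. prob_on K \<mu>}"
  have "A \<noteq> {}" using fin by (auto simp: A_def)
  then obtain f :: "nat \<Rightarrow> ennreal" where f: "decseq f" "range f \<subseteq> A" "Inf A = (INF i. f i)"
    using ennreal_Inf_countable_INF by metis
  have "\<forall>n. \<exists>\<mu>. prob_on K \<mu> \<and> f n = mutual_energy D \<mu> \<mu>"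
    using f(2) by (auto simp: A_def image_iff subset_eq)
  then obtain \<mu> where \<mu>: "\<And>n. prob_on K (\<mu> n)" "\<And>n. f n = mutual_energy D (\<mu> n) (\<mu> n)"
    by metis
  obtain r :: "nat \<Rightarrow> nat" and \<Omega> :: "real measure" and X Y where
    r: "strict_mono r" and ps: "prob_space \<Omega>" and X[measurable]: "\<And>n. X n \<in> borel_measurable \<Omega>" and
    dX: "\<And>n. distr \<Omega> borel (X n) = \<mu> (r n)" and Y[measurable]: "Y \<in> borel_measurable \<Omega>" and
    conv: "\<And>\<omega>. \<omega> \<in> space \<Omega> \<Longrightarrow> (\<lambda>n. X n \<omega>) \<longlonglongrightarrow> Y \<omega>" and PY: "prob_on K (distr \<Omega> borel Y)"
    by (rule prob_on_subsequence[of K \<mu>, OF K \<mu>(1)]) (rule that)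
  interpret prob_space \<Omega> by fact
  have d: "mutual_energy D (distr \<Omega> borel Z) (distr \<Omega> borel Z) =
      (\<integral>\<^sup>+ \<omega>. \<integral>\<^sup>+ \<omega>'. log_kernel D (Z \<omega>) (Z \<omega>') \<partial>\<Omega> \<partial>\<Omega>)"
    if [measurable]: "Z \<in> borel_measurable \<Omega>" for Z
  proof -
    have [measurable]: "log_pot D (distr \<Omega> borel Z) \<in> borel_measurable borel"
      by (rule measurable_log_pot) (auto intro!: prob_space_distr)
    show ?thesis
      unfolding mutual_energy_def
      by (subst nn_integral_distr, measurable, simp add: log_pot_def, subst nn_integral_distr) auto
  qed
  have "mutual_energy D (distr \<Omega> borel Y) (distr \<Omega> borel Y) \<le>
     (\<integral>\<^sup>+ \<omega>. \<integral>\<^sup>+ \<omega>'. liminf (\<lambda>n. log_kernel D (X n \<omega>) (X n \<omega>')) \<partial>\<Omega> \<partial>\<Omega>)"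
    unfolding d[OF Y] by (intro nn_integral_mono log_kernel_liminf D conv)
  also have "\<dots> \<le> (\<integral>\<^sup>+ \<omega>. liminf (\<lambda>n. \<integral>\<^sup>+ \<omega>'. log_kernel D (X n \<omega>) (X n \<omega>') \<partial>\<Omega>) \<partial>\<Omega>)"
    by (intro nn_integral_mono nn_integral_liminf) measurable
  also have "\<dots> \<le> liminf (\<lambda>n. \<integral>\<^sup>+ \<omega>. \<integral>\<^sup>+ \<omega>'. log_kernel D (X n \<omega>) (X n \<omega>') \<partial>\<Omega> \<partial>\<Omega>)"
    by (intro nn_integral_liminf) measurable
  also have "\<dots> = liminf (\<lambda>n. f (r n))"
    unfolding d[OF X, symmetric] dX \<mu>(2) ..
  also have "\<dots> = Inf A"
  proof -
    have "(f \<circ> r) \<longlonglongrightarrow> Inf A"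
      unfolding f(3) by (intro LIMSEQ_subseq_LIMSEQ[OF _ r] LIMSEQ_INF f(1))
    then show ?thesis by (simp add: lim_imp_Liminf o_def)
  qed
  finally have "mutual_energy D (distr \<Omega> borel Y) (distr \<Omega> borel Y) \<le> mutual_energy D \<nu> \<nu>"
    if "prob_on K \<nu>" for \<nu>
    using Inf_lower[of "mutual_energy D \<nu> \<nu>" A] that by (force simp: A_def)
  then show ?thesis unfolding energy_minimiser_def using PY fin le_less_trans by blast
qed

section \<open>Convex combinations and the first variation of the energy\<close>

text \<open>The convex combination (1 - p) \<mu> + p \<nu>, built as a two-stage experiment so that
  its integrals come from the formula for a monadic bind; p is the weight of
  \<open>\<nu>\<close>.\<close>

definition mixture :: "real \<Rightarrow> 'a measure \<Rightarrow> 'a measure \<Rightarrow> 'a measure" where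
  "mixture p \<mu> \<nu> = measure_pmf (bernoulli_pmf p) \<bind> (\<lambda>b. if b then \<nu> else \<mu>)"

lemma mixture:
  assumes \<mu>: "prob_on K \<mu>" and \<nu>: "prob_on K \<nu>" and p: "0 \<le> p" "p \<le> 1"
  shows nn_integral_mixture: "f \<in> borel_measurable borel \<Longrightarrow>
      (\<integral>\<^sup>+ z. f z \<partial>mixture p \<mu> \<nu>) = ennreal p * (\<integral>\<^sup>+ z. f z \<partial>\<nu>) + ennreal (1 - p) * (\<integral>\<^sup>+ z. f z \<partial>\<mu>)"
    and prob_on_mixture: "closed K \<Longrightarrow> prob_on K (mixture p \<mu> \<nu>)"
proof -
  have B: "(\<lambda>b. if b then \<nu> else \<mu>) \<in> measure_pmf (bernoulli_pmf p) \<rightarrow>\<^sub>M prob_algebra borel"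
    using \<mu> \<nu> by (auto simp: space_prob_algebra prob_on_def)
  show n: "(\<integral>\<^sup>+ z. f z \<partial>mixture p \<mu> \<nu>) = ennreal p * (\<integral>\<^sup>+ z. f z \<partial>\<nu>) + ennreal (1 - p) * (\<integral>\<^sup>+ z. f z \<partial>\<mu>)"
    if "f \<in> borel_measurable borel" for f
    unfolding mixture_def using p
    by (subst nn_integral_bind[OF that measurable_prob_algebraD[OF B]]) (simp add: mult.commute)
  have A: "measure_pmf (bernoulli_pmf p) \<in> space (prob_algebra (measure_pmf (bernoulli_pmf p)))"
    by (simp add: space_prob_algebra measure_pmf.prob_space_axioms)
  have s: "sets (mixture p \<mu> \<nu>) = sets borel"
    unfolding mixture_def by (rule sets_bind'[OF A]) (use B in \<open>simp add: measurable_def\<close>)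
  show "prob_on K (mixture p \<mu> \<nu>)" if K: "closed K"
  proof -
    have [measurable]: "UNIV - K \<in> sets borel" using K by (simp add: borel_closed sets.Diff)
    have "emeasure (mixture p \<mu> \<nu>) (UNIV - K) = (\<integral>\<^sup>+ z. indicator (UNIV - K) z \<partial>mixture p \<mu> \<nu>)"
      by (subst nn_integral_indicator) (simp_all add: s)
    also have "\<dots> = ennreal p * emeasure \<nu> (UNIV - K) + ennreal (1 - p) * emeasure \<mu> (UNIV - K)"
      using \<mu> \<nu> by (subst n, measurable, subst (1 2) nn_integral_indicator) (simp_all add: prob_on_def)
    also have "\<dots> = 0" using \<mu> \<nu> by (simp add: prob_on_def)
    finally show ?thesis
      using s prob_space_bind'[OF A B] by (simp add: prob_on_def mixture_def)
  qed
qed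

text \<open>The energy of (1 - p) \<mu> + p \<nu> is a quadratic in p that is smallest at p = 0, so
  its derivative there, twice the difference of the two sides, is nonnegative.\<close>

lemma energy_minimiser_mutual_energy_ge:
  assumes K: "closed K" and \<mu>: "energy_minimiser D K \<mu>"
    and \<nu>: "prob_on K \<nu>" "mutual_energy D \<nu> \<nu> < \<infinity>"
  shows "mutual_energy D \<mu> \<mu> \<le> mutual_energy D \<mu> \<nu>"
proof (cases "mutual_energy D \<mu> \<nu> = \<infinity>")
  case False
  have \<mu>p: "prob_on K \<mu>" using \<mu> by (simp add: energy_minimiser_def)
  have ps: "prob_space \<mu>" "sets \<mu> = sets borel" "prob_space \<nu>" "sets \<nu> = sets borel"
    using \<mu>p \<nu> by (auto simp: prob_on_def)
  obtain a b c where abc: "mutual_energy D \<mu> \<mu> = ennreal a" "mutual_energy D \<mu> \<nu> = ennreal b"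
    "mutual_energy D \<nu> \<nu> = ennreal c" "a \<ge> 0" "b \<ge> 0" "c \<ge> 0"
    using \<mu> \<nu> False unfolding energy_minimiser_def
    by (metis ennreal_cases infinity_ennreal_def less_irrefl)
  have [measurable]: "log_pot D \<mu> \<in> borel_measurable borel" "log_pot D \<nu> \<in> borel_measurable borel"
    using ps by (auto intro: measurable_log_pot)
  \<comment> \<open>This is a \<le> (1 - p)^2 a + 2 p (1 - p) b + p^2 c with the terms in a
    collected and a factor p cancelled, so that p tending to 0 leaves 2 a \<le> 2 b.\<close>
  have ineq: "(2 - p) * a \<le> 2 * (1 - p) * b + p * c" if p: "0 < p" "p < 1" for p
  proof -
    let ?\<rho> = "mixture p \<mu> \<nu>"
    note n = nn_integral_mixture[OF \<mu>p \<nu>(1) less_imp_le[OF p(1)] less_imp_le[OF p(2)]]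
    have \<rho>: "log_pot D ?\<rho> z = ennreal p * log_pot D \<nu> z + ennreal (1 - p) * log_pot D \<mu> z" for z
      unfolding log_pot_def by (rule n) measurable
    have [measurable]: "log_pot D ?\<rho> \<in> borel_measurable borel" unfolding \<rho> by measurable
    have e: "(\<integral>\<^sup>+ z. log_pot D ?\<rho> z \<partial>\<tau>) = ennreal p * mutual_energy D \<tau> \<nu> + ennreal (1 - p) * mutual_energy D \<tau> \<mu>"
      if [measurable_cong]: "sets \<tau> = sets borel" for \<tau>
      unfolding \<rho> mutual_energy_def by (simp add: nn_integral_add nn_integral_cmult)
    have "ennreal a \<le> mutual_energy D ?\<rho> ?\<rho>"
      using \<mu> prob_on_mixture[OF \<mu>p \<nu>(1) _ _ K, of p] p abc(1)
      by (auto simp: energy_minimiser_def)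
    also have "\<dots> = ennreal p * (ennreal p * ennreal c + ennreal (1 - p) * ennreal b)
        + ennreal (1 - p) * (ennreal p * ennreal b + ennreal (1 - p) * ennreal a)"
      unfolding mutual_energy_def[of D ?\<rho>]
      by (subst n) (simp_all add: e ps abc mutual_energy_commute[of \<nu> \<mu>])
    also have "\<dots> = ennreal (p * (p * c + (1 - p) * b) + (1 - p) * (p * b + (1 - p) * a))"
      using abc p by (simp flip: ennreal_mult ennreal_plus)
    finally have "a \<le> p * (p * c + (1 - p) * b) + (1 - p) * (p * b + (1 - p) * a)"
      using abc p by (subst (asm) ennreal_le_iff) auto
    then have "p * ((2 - p) * a) \<le> p * (2 * (1 - p) * b + p * c)" by (simp add: algebra_simps)
    then show ?thesis using p by simp
  qed
  have "2 * a \<le> 2 * b"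
  proof (rule tendsto_le[of "at_right 0"])
    have "((\<lambda>p. 2 * (1 - p) * b + p * c) \<longlongrightarrow> 2 * (1 - 0) * b + 0 * c) (at_right 0)"
      by (intro tendsto_intros)
    then show "((\<lambda>p. 2 * (1 - p) * b + p * c) \<longlongrightarrow> 2 * b) (at_right 0)" by simp
    have "((\<lambda>p. (2 - p) * a) \<longlongrightarrow> (2 - 0) * a) (at_right 0)"
      by (intro tendsto_intros)
    then show "((\<lambda>p. (2 - p) * a) \<longlongrightarrow> 2 * a) (at_right 0)" by simp
    show "\<forall>\<^sub>F p in at_right 0. (2 - p) * a \<le> 2 * (1 - p) * b + p * c"
      using ineq by (auto simp: eventually_at_right_field intro: exI[where x=1])
  qed simp
  then show ?thesis using abc by simp
qed simp

section \<open>Uniqueness of the energy minimiser\<close>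

lemma nn_integral_exp_scaled:
  assumes "s > 0"
  shows "(\<integral>\<^sup>+ t. ennreal (exp (- t * s)) * indicator {0..} t \<partial>lborel) = ennreal (1 / s)"
proof -
  have "((\<lambda>t. - exp (- t * s) / s) \<longlongrightarrow> 0) at_top"
  proof -
    have "filterlim (\<lambda>t. s * t) at_top at_top"
      using assms by (intro filterlim_tendsto_pos_mult_at_top[OF tendsto_const _ filterlim_ident])
    then have "filterlim (\<lambda>t. - t * s) at_bot at_top"
      by (simp add: mult.commute filterlim_uminus_at_bot)
    then have "((\<lambda>t. exp (- t * s)) \<longlongrightarrow> 0) at_top"
      by (rule filterlim_compose[OF exp_at_bot])
    then have "((\<lambda>t. - exp (- t * s) / s) \<longlongrightarrow> - 0 / s) at_top"
      using assms by (intro tendsto_intros) auto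
    then show ?thesis by simp
  qed
  then have "(\<integral>\<^sup>+ t. ennreal (exp (- t * s)) * indicator {0..} t \<partial>lborel) = 0 - (- exp (- 0 * s) / s)"
    using assms by (intro nn_integral_FTC_atLeast) (auto intro!: derivative_eq_intros)
  then show ?thesis by simp
qed

text \<open>The quotient is the integral of exp(-t s) over s in [a, b]; Tonelli then leaves the
  integral of 1 / s.\<close>

lemma nn_integral_Frullani:
  assumes a: "0 < a" and ab: "a \<le> b"
  shows "(\<integral>\<^sup>+ t. ennreal ((exp (- t * a) - exp (- t * b)) / t) * indicator {0<..} t \<partial>lborel) = ennreal (ln (b / a))"
proof -
  have "(\<integral>\<^sup>+ t. ennreal ((exp (- t * a) - exp (- t * b)) / t) * indicator {0<..} t \<partial>lborel) =
    (\<integral>\<^sup>+ t. (\<integral>\<^sup>+ s. ennreal (exp (- t * s)) * indicator {0<..} t * indicator {a..b} s \<partial>lborel) \<partial>lborel)"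
  proof (rule nn_integral_cong)
    fix t :: real
    show "ennreal ((exp (- t * a) - exp (- t * b)) / t) * indicator {0<..} t =
      (\<integral>\<^sup>+ s. ennreal (exp (- t * s)) * indicator {0<..} t * indicator {a..b} s \<partial>lborel)"
    proof (cases "t > 0")
      case True
      have "(\<integral>\<^sup>+ s. ennreal (exp (- t * s)) * indicator {a..b} s \<partial>lborel) =
          (- exp (- t * b) / t) - (- exp (- t * a) / t)"
        using True ab by (intro nn_integral_FTC_Icc) (auto intro!: derivative_eq_intros)
      then show ?thesis using True by (simp add: diff_divide_distrib)
    qed simp
  qed
  also have "\<dots> = (\<integral>\<^sup>+ s. (\<integral>\<^sup>+ t. ennreal (exp (- t * s)) * indicator {0<..} t * indicator {a..b} s \<partial>lborel) \<partial>lborel)"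
    by (rule lborel_pair.Fubini') measurable
  also have "\<dots> = (\<integral>\<^sup>+ s. ennreal (1 / s) * indicator {a..b} s \<partial>lborel)"
  proof (rule nn_integral_cong)
    fix s :: real
    show "(\<integral>\<^sup>+ t. ennreal (exp (- t * s)) * indicator {0<..} t * indicator {a..b} s \<partial>lborel) =
        ennreal (1 / s) * indicator {a..b} s"
    proof (cases "s \<in> {a..b}")
      case True
      then have "s > 0" using a by auto
      have "(\<integral>\<^sup>+ t. ennreal (exp (- t * s)) * indicator {0<..} t \<partial>lborel) =
          (\<integral>\<^sup>+ t. ennreal (exp (- t * s)) * indicator {0..} t \<partial>lborel)"
        by (rule nn_integral_cong_AE, rule AE_mp[OF AE_lborel_singleton[of 0]])
          (auto split: split_indicator)
      then show ?thesis using nn_integral_exp_scaled[OF \<open>s > 0\<close>] True by simp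
    qed simp
  qed
  also have "\<dots> = ln b - ln a"
    using a ab by (intro nn_integral_FTC_Icc) (auto intro!: derivative_eq_intros simp: divide_inverse)
  finally show ?thesis using a ab by (simp add: ln_div)
qed

text \<open>The Frullani integrand for a = r^2 and b = D^2, halved because ln(D^2 / r^2) = 2 ln(D /
  r). As a function of the distance r it is a multiple of a Gaussian minus a constant, and the
  constant cancels when energies of probability measures are compared.\<close>

definition gauss_slice :: "real \<Rightarrow> real \<Rightarrow> real \<Rightarrow> real" where
  "gauss_slice D t r = (exp (- t * r\<^sup>2) - exp (- t * D\<^sup>2)) / (2 * t)"

lemma log_kernel_gauss:
  assumes D: "D > 0" and r: "cmod (z - w) \<le> D"
  shows "log_kernel D z w = (\<integral>\<^sup>+ t. ennreal (gauss_slice D t (cmod (z - w))) * indicator {0<..} t \<partial>lborel)"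
proof -
  have *: "(\<integral>\<^sup>+ t. ennreal (gauss_slice D t r) * indicator {0<..} t \<partial>lborel) = ennreal (ln (D / r))"
    if r: "0 < r" "r \<le> D" for r
  proof -
    have "(\<integral>\<^sup>+ t. ennreal (gauss_slice D t r) * indicator {0<..} t \<partial>lborel) =
      (\<integral>\<^sup>+ t. ennreal (1/2) * (ennreal ((exp (- t * r\<^sup>2) - exp (- t * D\<^sup>2)) / t) * indicator {0<..} t) \<partial>lborel)"
    proof (rule nn_integral_cong)
      fix t :: real
      have "ennreal (gauss_slice D t r) = ennreal (1/2) * ennreal ((exp (- t * r\<^sup>2) - exp (- t * D\<^sup>2)) / t)" if "t > 0"
        using r that by (subst ennreal_mult[symmetric]) (auto simp: gauss_slice_def power_mono)
      then show "ennreal (gauss_slice D t r) * indicator {0<..} t =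
          ennreal (1/2) * (ennreal ((exp (- t * r\<^sup>2) - exp (- t * D\<^sup>2)) / t) * indicator {0<..} t)"
        by (auto split: split_indicator)
    qed
    also have "\<dots> = ennreal (1/2) * ennreal (ln (D\<^sup>2 / r\<^sup>2))"
      using r by (subst nn_integral_cmult, measurable, subst nn_integral_Frullani) (auto simp: power_mono)
    also have "\<dots> = ennreal (1/2 * ln ((D / r)\<^sup>2))"
      using r by (subst ennreal_mult) (auto simp: power_divide intro!: ln_ge_zero)
    also have "1/2 * ln ((D / r)\<^sup>2) = ln (D / r)"
      using r D by (simp add: ln_realpow)
    finally show ?thesis .
  qed
  show ?thesis
  proof (cases "z = w")
    case False
    then show ?thesis using *[of "cmod (z - w)"] r by (simp add: log_kernel_def)
  next
    case True
    let ?I = "\<integral>\<^sup>+ t. ennreal (gauss_slice D t 0) * indicator {0<..} t \<partial>lborel"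
    \<comment> \<open>On the diagonal: the slices decrease in r, and the slice at radius D exp(-n)
      integrates to exactly n.\<close>
    have "of_nat n \<le> ?I" for n
    proof -
      have "ennreal (ln (D / (D * exp (- real n)))) =
          (\<integral>\<^sup>+ t. ennreal (gauss_slice D t (D * exp (- real n))) * indicator {0<..} t \<partial>lborel)"
        using D by (intro *[symmetric]) auto
      also have "\<dots> \<le> ?I"
        by (intro nn_integral_mono)
          (auto simp: gauss_slice_def split: split_indicator intro!: ennreal_leI divide_right_mono)
      also have "ln (D / (D * exp (- real n))) = n" using D by (simp add: exp_minus inverse_eq_divide)
      finally show ?thesis by (simp add: ennreal_of_nat_eq_real_of_nat)
    qed
    then have "?I = \<infinity>"
      using ennreal_Ex_less_of_nat[of ?I] by (metis infinity_ennreal_def leD top.not_eq_extremum)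
    then show ?thesis using True by (simp add: log_kernel_def)
  qed
qed

section \<open>Gaussian-weighted moments determine a measure on K\<close>

lemma integrable_continuous_prob_on:
  fixes f :: "complex \<Rightarrow> real"
  assumes \<mu>: "prob_on K \<mu>" and K: "compact K" and f: "continuous_on UNIV f"
  shows "integrable \<mu> f"
proof -
  interpret prob_space \<mu> using \<mu> by (simp add: prob_on_def)
  have "compact (f ` K)" using K f by (intro compact_continuous_image) (auto intro: continuous_on_subset)
  from compact_imp_bounded[OF this] obtain B where "\<And>z. z \<in> K \<Longrightarrow> norm (f z) \<le> B"
     by (auto simp: bounded_iff)
  then have "AE z in \<mu>. norm (f z) \<le> B"
    using prob_on_AE[OF \<mu> compact_imp_closed[OF K]] by (auto elim!: eventually_mono)
  moreover have "f \<in> borel_measurable \<mu>"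
    using borel_measurable_continuous_onI[OF f] \<mu> measurable_cong_sets[of \<mu> borel borel borel]
    by (auto simp: prob_on_def)
  ultimately show ?thesis by (rule integrable_const_bound)
qed

text \<open>The functions max(0, 1 - n infdist z C) converge to the indicator of a closed set C, and
  the closed sets form an intersection-stable generator of the Borel sets.\<close>

lemma prob_on_eqI_continuous:
  assumes \<mu>: "prob_on K \<mu>" and \<nu>: "prob_on K \<nu>"
    and eq: "\<And>f :: complex \<Rightarrow> real. continuous_on UNIV f \<Longrightarrow> (\<integral>z. f z \<partial>\<mu>) = (\<integral>z. f z \<partial>\<nu>)"
  shows "\<mu> = \<nu>"
proof -
  have lim: "(\<lambda>n. \<integral>z. max 0 (1 - real n * infdist z C) \<partial>\<rho>) \<longlonglongrightarrow> measure \<rho> C"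
    if \<rho>: "prob_on K \<rho>" and C: "closed C" "C \<noteq> {}" for \<rho> C
  proof -
    interpret prob_space \<rho> using \<rho> by (simp add: prob_on_def)
    have s[measurable_cong]: "sets \<rho> = sets borel" using \<rho> by (simp add: prob_on_def)
    have sp: "space \<rho> = UNIV" using sets_eq_imp_space_eq[OF s] by simp
    have [measurable]: "C \<in> sets borel" using C(1) by (rule borel_closed)
    have [measurable]: "(\<lambda>z. infdist z C) \<in> borel_measurable borel"
      by (intro borel_measurable_continuous_onI continuous_intros)
    have "(\<lambda>n. \<integral>z. max 0 (1 - real n * infdist z C) \<partial>\<rho>) \<longlonglongrightarrow> (\<integral>z. indicator C z \<partial>\<rho>)"
    proof (rule integral_dominated_convergence[where w="\<lambda>_. 1"])
      show "AE z in \<rho>. (\<lambda>n. max 0 (1 - real n * infdist z C)) \<longlonglongrightarrow> indicator C z"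
      proof (rule AE_I2)
        fix z
        show "(\<lambda>n. max 0 (1 - real n * infdist z C)) \<longlonglongrightarrow> indicator C z"
        proof (cases "z \<in> C")
          case False
          then have d: "infdist z C > 0"
            using C infdist_nonneg[of z C] by (metis in_closed_iff_infdist_zero less_eq_real_def)
          obtain N :: nat where N: "1 < real N * infdist z C"
            using reals_Archimedean3[OF d] by blast
          have "\<forall>\<^sub>F n in sequentially. max 0 (1 - real n * infdist z C) = 0"
            using eventually_ge_at_top[of N]
          proof eventually_elim
            case (elim n)
            then have "real N * infdist z C \<le> real n * infdist z C"
              using d by (intro mult_right_mono) auto
            then show ?case using N by simp
          qed
          then show ?thesis using False by (simp add: tendsto_eventually)
        qed simp
      qed
      show "AE z in \<rho>. norm (max 0 (1 - real n * infdist z C)) \<le> 1" for n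
        by (simp add: infdist_nonneg)
    qed (use C in measurable)
    then show ?thesis using sp by simp
  qed
  have closed: "emeasure \<mu> C = emeasure \<nu> C" if C: "closed C" for C
  proof (cases "C = {}")
    case False
    have "(\<integral>z. max 0 (1 - real n * infdist z C) \<partial>\<mu>) = (\<integral>z. max 0 (1 - real n * infdist z C) \<partial>\<nu>)" for n
      by (intro eq continuous_intros)
    then have "measure \<mu> C = measure \<nu> C"
      using lim[OF \<mu> C False] lim[OF \<nu> C False] by (simp add: LIMSEQ_unique)
    then show ?thesis
      using \<mu> \<nu> by (auto simp: prob_on_def prob_space_def finite_measure.emeasure_eq_measure)
  qed simp
  have s: "sets \<mu> = sets borel" "sets \<nu> = sets borel" using \<mu> \<nu> by (auto simp: prob_on_def)
  show ?thesis
  proof (rule measure_eqI_generator_eq[where E="Collect closed" and \<Omega>=UNIV and A="\<lambda>_. UNIV"])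
    show "Int_stable (Collect closed :: complex set set)" by (auto simp: Int_stable_def)
    show "sets \<mu> = sigma_sets UNIV (Collect closed)" "sets \<nu> = sigma_sets UNIV (Collect closed)"
      unfolding s borel_eq_closed by simp_all
    show "emeasure \<mu> UNIV \<noteq> \<infinity>" for i :: nat
      using \<mu> by (simp add: prob_on_def prob_space_def finite_measure.emeasure_eq_measure)
  qed (use closed in auto)
qed

text \<open>The real polynomials in Re z and Im z, generated from monomials so that equality of
  moments spreads to all of them by induction.\<close>

inductive_set xy_span :: "(complex \<Rightarrow> real) set" where
  monom: "(\<lambda>z. Re z ^ k * Im z ^ l) \<in> xy_span"
| add: "f \<in> xy_span \<Longrightarrow> g \<in> xy_span \<Longrightarrow> (\<lambda>z. f z + g z) \<in> xy_span"
| scale: "f \<in> xy_span \<Longrightarrow> (\<lambda>z. c * f z) \<in> xy_span"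

lemma continuous_xy_span: "f \<in> xy_span \<Longrightarrow> continuous_on UNIV f"
  by (induction rule: xy_span.induct) (auto intro!: continuous_intros)

lemma xy_span_times_Re: "f \<in> xy_span \<Longrightarrow> (\<lambda>z. Re z * f z) \<in> xy_span"
proof (induction rule: xy_span.induct)
  case (monom k l)
  show ?case using xy_span.monom[of "Suc k" l] by (simp add: mult.assoc)
next
  case (add f g)
  show ?case using xy_span.add[OF add.IH] by (simp add: distrib_left)
next
  case (scale f c)
  show ?case using xy_span.scale[OF scale.IH, of c] by (simp add: mult.left_commute)
qed

lemma xy_span_times_Im: "f \<in> xy_span \<Longrightarrow> (\<lambda>z. Im z * f z) \<in> xy_span"
proof (induction rule: xy_span.induct)
  case (monom k l)
  show ?case using xy_span.monom[of k "Suc l"] by (simp add: mult.left_commute)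
next
  case (add f g)
  show ?case using xy_span.add[OF add.IH] by (simp add: distrib_left)
next
  case (scale f c)
  show ?case using xy_span.scale[OF scale.IH, of c] by (simp add: mult.left_commute)
qed

text \<open>The induction shows instead that multiplication by p preserves \<open>xy_span\<close>; a
  product is then handled by composing two multiplications, and applying the result to the constant
  1 gives the claim.\<close>

lemma real_polynomial_function_xy_span:
  assumes "real_polynomial_function p"
  shows "p \<in> xy_span"
proof -
  have "(\<lambda>z. p z * f z) \<in> xy_span" if "f \<in> xy_span" for f
    using assms that
  proof (induction arbitrary: f)
    case (linear h)
    interpret bounded_linear h by fact
    have h: "h z = Re z * h 1 + Im z * h \<i>" for z
    proof -
      have "h z = h (Re z *\<^sub>R 1 + Im z *\<^sub>R \<i>)"
        by (rule arg_cong[where f=h]) (simp add: complex_eq_iff)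
      then show ?thesis by (simp only: add scaleR) simp
    qed
    have "(\<lambda>z. h z * f z) = (\<lambda>z. h 1 * (Re z * f z) + h \<i> * (Im z * f z))"
      by (rule ext, subst h) (simp add: algebra_simps)
    then show ?case
      using xy_span.add[OF xy_span.scale[OF xy_span_times_Re[OF linear.prems]]
          xy_span.scale[OF xy_span_times_Im[OF linear.prems]], of "h 1" "h \<i>"] by simp
  next
    case (const c)
    then show ?case by (rule xy_span.scale)
  next
    case (add p q)
    then show ?case using xy_span.add[OF add.IH] by (simp add: distrib_right)
  next
    case (mult p q)
    show ?case using mult.IH(1)[OF mult.IH(2)[OF mult.prems]] by (simp add: mult.assoc)
  qed
  from this[OF xy_span.monom[of 0 0]] show ?thesis by simp
qed

definition gauss_moment :: "real \<Rightarrow> complex measure \<Rightarrow> nat \<Rightarrow> nat \<Rightarrow> real" where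
  "gauss_moment t \<mu> k l = (\<integral>z. exp (- t * (cmod z)\<^sup>2) * (Re z ^ k * Im z ^ l) \<partial>\<mu>)"

text \<open>The weight e is positive, so Stone-Weierstrass approximates f / e on K by polynomials,
  whose e-weighted integrals agree; multiplying back by e \<le> 1 does not enlarge the
  error.\<close>

lemma prob_on_eqI_gauss_moments:
  assumes \<mu>: "prob_on K \<mu>" and \<nu>: "prob_on K \<nu>" and K: "compact K" and t: "t > 0"
    and eq: "\<And>k l. gauss_moment t \<mu> k l = gauss_moment t \<nu> k l"
  shows "\<mu> = \<nu>"
proof (rule prob_on_eqI_continuous[OF \<mu> \<nu>])
  fix f :: "complex \<Rightarrow> real" assume f: "continuous_on UNIV f"
  define e where "e z = exp (- t * (cmod z)\<^sup>2)" for z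
  have e: "continuous_on A e" "e z > 0" "e z \<le> 1" for A z
    unfolding e_def using t by (auto intro!: continuous_intros)
  have int: "integrable \<rho> (\<lambda>z. e z * g z)" if "prob_on K \<rho>" "g \<in> xy_span" for \<rho> g
    using that by (intro integrable_continuous_prob_on[OF _ K] continuous_intros e continuous_xy_span)
  have span: "(\<integral>z. e z * g z \<partial>\<mu>) = (\<integral>z. e z * g z \<partial>\<nu>)" if "g \<in> xy_span" for g
    using that
  proof (induction rule: xy_span.induct)
    case (monom k l)
    then show ?case using eq[of k l] by (simp add: gauss_moment_def e_def)
  next
    case (add f g)
    then show ?case by (simp add: distrib_left int[OF \<mu>] int[OF \<nu>])
  next
    case (scale f c)
    then show ?case by (simp add: mult.left_commute[of _ c])
  qed
  show "(\<integral>z. f z \<partial>\<mu>) = (\<integral>z. f z \<partial>\<nu>)"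
  proof (rule ccontr)
    assume ne: "(\<integral>z. f z \<partial>\<mu>) \<noteq> (\<integral>z. f z \<partial>\<nu>)"
    \<comment> \<open>A third of the gap: two approximation errors of size \<epsilon> cannot bridge
      3 \<epsilon>.\<close>
    define \<epsilon> where "\<epsilon> = \<bar>(\<integral>z. f z \<partial>\<mu>) - (\<integral>z. f z \<partial>\<nu>)\<bar> / 3"
    have "\<epsilon> > 0" using ne by (simp add: \<epsilon>_def)
    have "continuous_on K (\<lambda>z. f z / e z)"
      using continuous_on_subset[OF f] e by (intro continuous_intros) (auto simp: less_imp_neq[symmetric])
    then obtain g where g: "real_polynomial_function g" "\<And>z. z \<in> K \<Longrightarrow> \<bar>f z / e z - g z\<bar> < \<epsilon>"
      using Stone_Weierstrass_real_polynomial_function[OF K _ \<open>\<epsilon> > 0\<close>] by blast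
    note gs = real_polynomial_function_xy_span[OF g(1)]
    have close: "\<bar>f z - e z * g z\<bar> \<le> \<epsilon>" if "z \<in> K" for z
    proof -
      have "\<bar>f z - e z * g z\<bar> = e z * \<bar>f z / e z - g z\<bar>"
        using e(2)[of z] by (subst abs_of_pos[of "e z", symmetric], simp, subst abs_mult[symmetric])
          (simp add: right_diff_distrib)
      also have "\<dots> \<le> 1 * \<epsilon>"
        using g(2)[OF that] e by (intro mult_mono) (auto simp: less_imp_le)
      finally show ?thesis by simp
    qed
    have "\<bar>(\<integral>z. f z \<partial>\<rho>) - (\<integral>z. e z * g z \<partial>\<rho>)\<bar> \<le> \<epsilon>" if \<rho>: "prob_on K \<rho>" for \<rho>
    proof -
      interpret prob_space \<rho> using \<rho> by (simp add: prob_on_def)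
      note i = integrable_continuous_prob_on[OF \<rho> K f] int[OF \<rho> gs]
      have "\<bar>\<integral>z. f z - e z * g z \<partial>\<rho>\<bar> \<le> (\<integral>z. \<bar>f z - e z * g z\<bar> \<partial>\<rho>)"
        by (rule integral_abs_bound)
      also have "\<dots> \<le> (\<integral>z. \<epsilon> \<partial>\<rho>)"
        using prob_on_AE[OF \<rho> compact_imp_closed[OF K]] close i
        by (intro integral_mono_AE) (auto elim!: eventually_mono)
      finally show ?thesis using i by (simp add: prob_space)
    qed
    from this[OF \<mu>] this[OF \<nu>] span[OF gs] \<open>\<epsilon> > 0\<close> show False
      by (auto simp: \<epsilon>_def abs_if split: if_splits)
  qed
qed


text \<open>Writing \<open>|z - w|\<^sup>2 = |z|\<^sup>2 + |w|\<^sup>2 - 2 (Re z Re w + Im z Im w)\<close> and expanding the exponentials of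
  the two products gives \<open>gauss_energy\<close> as a positive combination of products of \<open>gauss_moment\<close>s.\<close>
definition gauss_energy :: "real \<Rightarrow> complex measure \<Rightarrow> complex measure \<Rightarrow> real" where
  "gauss_energy t \<mu> \<nu> = (\<integral>p. exp (- t * (cmod (fst p - snd p))\<^sup>2) \<partial>(\<mu> \<Otimes>\<^sub>M \<nu>))"

section \<open>Positive definiteness of the Gaussian energy\<close>

lemma abs_exp_partial_sum_le:
  fixes x :: real
  shows "\<bar>\<Sum>k<n. x ^ k / fact k\<bar> \<le> exp \<bar>x\<bar>"
proof -
  have s: "(\<lambda>k. \<bar>x\<bar> ^ k / fact k) sums exp \<bar>x\<bar>"
    using exp_converges[of "\<bar>x\<bar>"] by (simp add: divide_inverse mult.commute)
  have "\<bar>\<Sum>k<n. x ^ k / fact k\<bar> \<le> (\<Sum>k<n. \<bar>x\<bar> ^ k / fact k)"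
    by (rule order.trans[OF sum_abs]) (simp add: power_abs)
  also have "\<dots> \<le> exp \<bar>x\<bar>"
    unfolding sums_unique[OF s] by (rule sum_le_suminf[OF sums_summable[OF s]]) auto
  finally show ?thesis .
qed

lemma AE_pair_prob_on:
  assumes \<mu>: "prob_on K \<mu>" and \<nu>: "prob_on K \<nu>" and K: "closed K"
  shows "AE p in \<mu> \<Otimes>\<^sub>M \<nu>. fst p \<in> K \<and> snd p \<in> K"
proof -
  interpret \<mu>: prob_space \<mu> using \<mu> by (simp add: prob_on_def)
  interpret \<nu>: prob_space \<nu> using \<nu> by (simp add: prob_on_def)
  interpret P: pair_prob_space \<mu> \<nu> ..
  have [measurable_cong]: "sets \<mu> = sets borel" "sets \<nu> = sets borel"
    using \<mu> \<nu> by (auto simp: prob_on_def)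
  have [measurable]: "K \<in> sets borel" using K by (rule borel_closed)
  show ?thesis
  proof (rule P.AE_pair_measure)
    show "{p \<in> space (\<mu> \<Otimes>\<^sub>M \<nu>). fst p \<in> K \<and> snd p \<in> K} \<in> sets (\<mu> \<Otimes>\<^sub>M \<nu>)" by measurable
    show "AE x in \<mu>. AE y in \<nu>. fst (x, y) \<in> K \<and> snd (x, y) \<in> K"
      using prob_on_AE[OF \<mu> K]
    proof eventually_elim
      case (elim x)
      from prob_on_AE[OF \<nu> K] show ?case by eventually_elim (simp add: elim)
    qed
  qed
qed

text \<open>On the bounded set K the truncated exponential series are bounded uniformly in N, so
  dominated convergence moves the expansion through the integral. Each term is a function of z times
  the same function of w and integrates to a product of moments.\<close>

lemma gauss_energy_moments:
  assumes \<mu>: "prob_on K \<mu>" and \<nu>: "prob_on K \<nu>" and K: "compact K" and t: "t > 0"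
  shows "(\<lambda>N. \<Sum>k<N. \<Sum>l<N. ((2*t)^k / fact k * ((2*t)^l / fact l)) *
      (gauss_moment t \<mu> k l * gauss_moment t \<nu> k l)) \<longlonglongrightarrow> gauss_energy t \<mu> \<nu>"
proof -
  interpret \<mu>: prob_space \<mu> using \<mu> by (simp add: prob_on_def)
  interpret \<nu>: prob_space \<nu> using \<nu> by (simp add: prob_on_def)
  interpret P: pair_prob_space \<mu> \<nu> ..
  have [measurable_cong]: "sets \<mu> = sets borel" "sets \<nu> = sets borel"
    using \<mu> \<nu> by (auto simp: prob_on_def)
  obtain R where R: "\<And>z. z \<in> K \<Longrightarrow> cmod z \<le> R"
    using compact_imp_bounded[OF K] by (auto simp: bounded_iff)
  note AE = AE_pair_prob_on[OF \<mu> \<nu> compact_imp_closed[OF K]]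
  define e where "e z = exp (- t * (cmod z)\<^sup>2)" for z :: complex
  have e[measurable]: "e \<in> borel_measurable borel" and e1: "e z \<le> 1" "e z \<ge> 0" for z
    unfolding e_def using t by auto
  define g where "g k l z = e z * (Re z ^ k * Im z ^ l)" for k l z
  have g[measurable]: "g k l \<in> borel_measurable borel" for k l unfolding g_def by measurable
  have "continuous_on UNIV (g k l)" for k l unfolding g_def e_def by (intro continuous_intros)
  note ig = integrable_continuous_prob_on[OF \<mu> K this] integrable_continuous_prob_on[OF \<nu> K this]
  have mom: "gauss_moment t \<rho> k l = (\<integral>z. g k l z \<partial>\<rho>)" for \<rho> k l
    unfolding gauss_moment_def g_def e_def ..
  define S where "S N p = e (fst p) * e (snd p) * ((\<Sum>k<N. (2 * t * (Re (fst p) * Re (snd p))) ^ k / fact k) *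
      (\<Sum>k<N. (2 * t * (Im (fst p) * Im (snd p))) ^ k / fact k))" for N p
  define c where "c k = (2*t)^k / fact k" for k :: nat
  have S: "S N p = (\<Sum>k<N. \<Sum>l<N. (c k * c l) * (g k l (fst p) * g k l (snd p)))" for N p
    unfolding S_def sum_product
    by (subst sum_distrib_left, rule sum.cong[OF refl], subst sum_distrib_left, rule sum.cong[OF refl])
      (simp add: g_def c_def power_mult_distrib)
  have ip: "integrable (\<mu> \<Otimes>\<^sub>M \<nu>) (\<lambda>p. g k l (fst p) * g k l (snd p))" for k l
  proof (rule P.Fubini_integrable)
    show "integrable \<mu> (\<lambda>x. \<integral>y. norm (g k l (fst (x, y)) * g k l (snd (x, y))) \<partial>\<nu>)"
      using ig by (simp add: abs_mult)
  qed (use ig in simp_all)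
  have ep: "(\<integral>p. g k l (fst p) * g k l (snd p) \<partial>(\<mu> \<Otimes>\<^sub>M \<nu>)) = gauss_moment t \<mu> k l * gauss_moment t \<nu> k l" for k l
    using P.integral_fst'[OF ip[of k l]] by (simp add: mom)
  have "(\<lambda>N. \<integral>p. S N p \<partial>(\<mu> \<Otimes>\<^sub>M \<nu>)) \<longlonglongrightarrow> gauss_energy t \<mu> \<nu>"
    unfolding gauss_energy_def
  proof (rule integral_dominated_convergence[where w="\<lambda>_. exp (2 * t * R\<^sup>2) * exp (2 * t * R\<^sup>2)"])
    show "AE p in \<mu> \<Otimes>\<^sub>M \<nu>. (\<lambda>N. S N p) \<longlonglongrightarrow> exp (- t * (cmod (fst p - snd p))\<^sup>2)"
    proof (rule AE_I2)
      fix p :: "complex \<times> complex"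
      have ex: "(\<lambda>N. \<Sum>k<N. x ^ k / fact k) \<longlonglongrightarrow> exp x" for x :: real
        using exp_converges[of x] by (simp add: sums_def divide_inverse mult.commute)
      have "(\<lambda>N. S N p) \<longlonglongrightarrow> e (fst p) * e (snd p) *
          (exp (2 * t * (Re (fst p) * Re (snd p))) * exp (2 * t * (Im (fst p) * Im (snd p))))"
        unfolding S_def by (intro tendsto_mult tendsto_const ex)
      also have "e (fst p) * e (snd p) * (exp (2 * t * (Re (fst p) * Re (snd p))) * exp (2 * t * (Im (fst p) * Im (snd p))))
          = exp (- t * (cmod (fst p - snd p))\<^sup>2)"
        unfolding e_def exp_add[symmetric] cmod_power2
        by (rule arg_cong[where f=exp]) (simp add: algebra_simps power2_eq_square)
      finally show "(\<lambda>N. S N p) \<longlonglongrightarrow> exp (- t * (cmod (fst p - snd p))\<^sup>2)" .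
    qed
    show "AE p in \<mu> \<Otimes>\<^sub>M \<nu>. norm (S N p) \<le> exp (2 * t * R\<^sup>2) * exp (2 * t * R\<^sup>2)" for N
      using AE
    proof eventually_elim
      case (elim p)
      have b: "\<bar>a * b\<bar> \<le> R\<^sup>2" if "\<bar>a\<bar> \<le> R" "\<bar>b\<bar> \<le> R" for a b :: real
        using that by (auto simp: abs_mult power2_eq_square intro!: mult_mono)
      have R': "cmod (fst p) \<le> R" "cmod (snd p) \<le> R" using elim R by auto
      have s: "\<bar>\<Sum>k<N. (2 * t * x) ^ k / fact k\<bar> \<le> exp (2 * t * R\<^sup>2)" if "\<bar>x\<bar> \<le> R\<^sup>2" for x
        by (rule order.trans[OF abs_exp_partial_sum_le]) (use t that in \<open>auto simp: abs_mult\<close>)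
      have "norm (S N p) \<le> 1 * (exp (2 * t * R\<^sup>2) * exp (2 * t * R\<^sup>2))"
        unfolding S_def real_norm_def abs_mult
      proof (intro mult_mono s)
        show "\<bar>e (fst p)\<bar> * \<bar>e (snd p)\<bar> \<le> 1"
          using e1 by (simp add: mult_le_one)
        have "\<bar>Re (fst p)\<bar> \<le> R" "\<bar>Re (snd p)\<bar> \<le> R" "\<bar>Im (fst p)\<bar> \<le> R" "\<bar>Im (snd p)\<bar> \<le> R"
          using R' abs_Re_le_cmod abs_Im_le_cmod order.trans by blast+
        then show "\<bar>Re (fst p) * Re (snd p)\<bar> \<le> R\<^sup>2" "\<bar>Im (fst p) * Im (snd p)\<bar> \<le> R\<^sup>2"
          by (auto intro: b)
      qed auto
      then show ?case by simp
    qed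
    show "S N \<in> borel_measurable (\<mu> \<Otimes>\<^sub>M \<nu>)" for N unfolding S_def[abs_def] by measurable
  qed simp_all
  also have "(\<lambda>N. \<integral>p. S N p \<partial>(\<mu> \<Otimes>\<^sub>M \<nu>)) = (\<lambda>N. \<Sum>k<N. \<Sum>l<N. (c k * c l) *
      (gauss_moment t \<mu> k l * gauss_moment t \<nu> k l))"
    unfolding S by (subst Bochner_Integration.integral_sum, intro Bochner_Integration.integrable_sum integrable_mult_right ip,
        subst Bochner_Integration.integral_sum, intro integrable_mult_right ip) (simp add: ep)
  finally show ?thesis unfolding c_def .
qed

text \<open>By the moment expansion the right side is the sum over all k and l of terms like the one
  on the left, all nonnegative, so it dominates each of them. If it vanishes, all moments
  agree.\<close>

lemma gauss_energy_diff_ge: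
  assumes \<mu>: "prob_on K \<mu>" and \<nu>: "prob_on K \<nu>" and K: "compact K" and t: "t > 0"
  shows "(2*t)^k / fact k * ((2*t)^l / fact l) * (gauss_moment t \<mu> k l - gauss_moment t \<nu> k l)\<^sup>2 \<le>
     gauss_energy t \<mu> \<mu> + gauss_energy t \<nu> \<nu> - 2 * gauss_energy t \<mu> \<nu>"
proof (rule LIMSEQ_le_const)
  let ?m = "\<lambda>k l. gauss_moment t \<mu> k l" and ?n = "\<lambda>k l. gauss_moment t \<nu> k l"
  define c where "c k l = (2*t)^k / fact k * ((2*t)^l / fact l)" for k l :: nat
  have c: "c k l \<ge> 0" for k l using t by (simp add: c_def)
  have "(\<lambda>N. (\<Sum>k<N. \<Sum>l<N. c k l * (?m k l * ?m k l)) + (\<Sum>k<N. \<Sum>l<N. c k l * (?n k l * ?n k l))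
      - 2 * (\<Sum>k<N. \<Sum>l<N. c k l * (?m k l * ?n k l))) \<longlonglongrightarrow>
      gauss_energy t \<mu> \<mu> + gauss_energy t \<nu> \<nu> - 2 * gauss_energy t \<mu> \<nu>"
    unfolding c_def
    by (intro tendsto_add tendsto_diff tendsto_mult tendsto_const gauss_energy_moments[OF _ _ K t] \<mu> \<nu>)
  moreover have "(\<Sum>k<N. \<Sum>l<N. c k l * (?m k l * ?m k l)) + (\<Sum>k<N. \<Sum>l<N. c k l * (?n k l * ?n k l))
      - 2 * (\<Sum>k<N. \<Sum>l<N. c k l * (?m k l * ?n k l)) = (\<Sum>k<N. \<Sum>l<N. c k l * (?m k l - ?n k l)\<^sup>2)" for N
    unfolding sum_distrib_left sum.distrib[symmetric] sum_subtractf[symmetric]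
    by (intro sum.cong refl) (simp add: power2_eq_square algebra_simps)
  ultimately show "(\<lambda>N. \<Sum>k<N. \<Sum>l<N. c k l * (?m k l - ?n k l)\<^sup>2) \<longlonglongrightarrow>
      gauss_energy t \<mu> \<mu> + gauss_energy t \<nu> \<nu> - 2 * gauss_energy t \<mu> \<nu>" by simp
  have "c k l * (?m k l - ?n k l)\<^sup>2 \<le> (\<Sum>k<N. \<Sum>l<N. c k l * (?m k l - ?n k l)\<^sup>2)" if "N > max k l" for N
  proof -
    have "c k l * (?m k l - ?n k l)\<^sup>2 \<le> (\<Sum>l<N. c k l * (?m k l - ?n k l)\<^sup>2)"
      using that c by (intro member_le_sum) auto
    also have "\<dots> \<le> (\<Sum>k<N. \<Sum>l<N. c k l * (?m k l - ?n k l)\<^sup>2)"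
      using that c by (intro member_le_sum[where f="\<lambda>k. \<Sum>l<N. c k l * (?m k l - ?n k l)\<^sup>2"] sum_nonneg) auto
    finally show ?thesis .
  qed
  then show "\<exists>N0. \<forall>N\<ge>N0. (2*t)^k / fact k * ((2*t)^l / fact l) * (?m k l - ?n k l)\<^sup>2 \<le> (\<Sum>k<N. \<Sum>l<N. c k l * (?m k l - ?n k l)\<^sup>2)"
    unfolding c_def[symmetric] by (intro exI[where x="Suc (max k l)"]) (auto simp: Suc_le_eq)
qed

text \<open>Integrate \<open>log_kernel_gauss\<close> against both measures and exchange by Tonelli.
  The diameter of K is at most D, so each slice is nonnegative almost everywhere, which is the
  second claim.\<close>

lemma mutual_energy_gauss:
  assumes \<mu>: "prob_on K \<mu>" and \<nu>: "prob_on K \<nu>" and K: "compact K"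
    and D: "D > 0" "\<And>z. z \<in> K \<Longrightarrow> cmod z \<le> D / 2"
  shows "mutual_energy D \<mu> \<nu> =
      (\<integral>\<^sup>+ t. ennreal ((gauss_energy t \<mu> \<nu> - exp (- t * D\<^sup>2)) / (2 * t)) * indicator {0<..} t \<partial>lborel)"
    and "t > 0 \<Longrightarrow> exp (- t * D\<^sup>2) \<le> gauss_energy t \<mu> \<nu>"
    and "(\<lambda>t. gauss_energy t \<mu> \<nu>) \<in> borel_measurable borel"
proof -
  interpret \<mu>: prob_space \<mu> using \<mu> by (simp add: prob_on_def)
  interpret \<nu>: prob_space \<nu> using \<nu> by (simp add: prob_on_def)
  interpret P: pair_prob_space \<mu> \<nu> ..
  interpret Q: pair_sigma_finite "\<mu> \<Otimes>\<^sub>M \<nu>" lborel ..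
  have [measurable_cong]: "sets \<mu> = sets borel" "sets \<nu> = sets borel"
    using \<mu> \<nu> by (auto simp: prob_on_def)
  show [measurable]: "(\<lambda>t. gauss_energy t \<mu> \<nu>) \<in> borel_measurable borel"
    unfolding gauss_energy_def by measurable
  have d: "cmod (z - w) \<le> D" if "z \<in> K" "w \<in> K" for z w
    using D(2)[OF that(1)] D(2)[OF that(2)] norm_triangle_ineq4[of z w] by linarith
  have AE: "AE p in \<mu> \<Otimes>\<^sub>M \<nu>. cmod (fst p - snd p) \<le> D"
    using AE_pair_prob_on[OF \<mu> \<nu> compact_imp_closed[OF K]] by eventually_elim (simp add: d)
  have int: "integrable (\<mu> \<Otimes>\<^sub>M \<nu>) (\<lambda>p. exp (- t * (cmod (fst p - snd p))\<^sup>2))" if "t > 0" for t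
    using that by (intro P.integrable_const_bound[where B=1]) auto
  have slice: "(\<integral>p. gauss_slice D t (cmod (fst p - snd p)) \<partial>(\<mu> \<Otimes>\<^sub>M \<nu>)) = (gauss_energy t \<mu> \<nu> - exp (- t * D\<^sup>2)) / (2 * t)"
    if "t > 0" for t
    using int[OF that] unfolding gauss_slice_def gauss_energy_def by (simp add: P.prob_space)
  have pos: "AE p in \<mu> \<Otimes>\<^sub>M \<nu>. 0 \<le> gauss_slice D t (cmod (fst p - snd p))" if "t > 0" for t
    using AE by eventually_elim (use that in \<open>auto simp: gauss_slice_def power_mono\<close>)
  show "exp (- t * D\<^sup>2) \<le> gauss_energy t \<mu> \<nu>" if "t > 0"
    using integral_nonneg_AE[OF pos[OF that]] that unfolding slice[OF that] by (simp add: zero_le_divide_iff)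
  have "mutual_energy D \<mu> \<nu> = (\<integral>\<^sup>+ p. log_kernel D (fst p) (snd p) \<partial>(\<mu> \<Otimes>\<^sub>M \<nu>))"
    unfolding mutual_energy_def log_pot_def by (subst \<nu>.nn_integral_fst[symmetric]) auto
  also have "\<dots> = (\<integral>\<^sup>+ p. \<integral>\<^sup>+ t. ennreal (gauss_slice D t (cmod (fst p - snd p))) * indicator {0<..} t \<partial>lborel \<partial>(\<mu> \<Otimes>\<^sub>M \<nu>))"
    by (rule nn_integral_cong_AE) (use AE in \<open>eventually_elim, intro log_kernel_gauss D\<close>)
  also have "\<dots> = (\<integral>\<^sup>+ t. \<integral>\<^sup>+ p. ennreal (gauss_slice D t (cmod (fst p - snd p))) * indicator {0<..} t \<partial>(\<mu> \<Otimes>\<^sub>M \<nu>) \<partial>lborel)"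
    by (rule Q.Fubini'[symmetric]) (unfold gauss_slice_def, measurable)
  also have "\<dots> = (\<integral>\<^sup>+ t. ennreal ((gauss_energy t \<mu> \<nu> - exp (- t * D\<^sup>2)) / (2 * t)) * indicator {0<..} t \<partial>lborel)"
  proof (rule nn_integral_cong)
    fix t :: real
    show "(\<integral>\<^sup>+ p. ennreal (gauss_slice D t (cmod (fst p - snd p))) * indicator {0<..} t \<partial>(\<mu> \<Otimes>\<^sub>M \<nu>)) =
        ennreal ((gauss_energy t \<mu> \<nu> - exp (- t * D\<^sup>2)) / (2 * t)) * indicator {0<..} t"
    proof (cases "t > 0")
      case True
      have "integrable (\<mu> \<Otimes>\<^sub>M \<nu>) (\<lambda>p. gauss_slice D t (cmod (fst p - snd p)))"
        unfolding gauss_slice_def using int[OF True] by simp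
      from nn_integral_eq_integral[OF this pos[OF True]] show ?thesis
        using True by (simp add: slice)
    qed simp
  qed
  finally show "mutual_energy D \<mu> \<nu> =
      (\<integral>\<^sup>+ t. ennreal ((gauss_energy t \<mu> \<nu> - exp (- t * D\<^sup>2)) / (2 * t)) * indicator {0<..} t \<partial>lborel)" .
qed

lemma ennreal_add_eq_le_imp_0:
  fixes x a b :: ennreal
  assumes "x + b = a" "a \<le> b" "a < \<infinity>"
  shows "x = 0"
proof -
  have "b \<le> a" using assms(1) by (metis add.commute add_increasing2 order_refl zero_le)
  then have "a + x = a + 0" using assms by (simp add: add.commute antisym)
  then show ?thesis using assms(3) by (auto simp: ennreal_add_left_cancel)
qed

text \<open>Both energies equal E, and the first variation makes the mutual energy at least E, so
  the integral of the nonnegative \<open>\<Delta> t\<close> over t > 0 is at most 2 E - 2 E. One t >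
  0 with \<open>\<Delta> t = 0\<close> already forces all Gaussian moments to agree.\<close>

lemma energy_minimiser_unique:
  assumes K: "compact K" and D: "D > 0" "\<And>z. z \<in> K \<Longrightarrow> cmod z \<le> D / 2"
    and \<mu>: "energy_minimiser D K \<mu>" and \<nu>: "energy_minimiser D K \<nu>"
  shows "\<mu> = \<nu>"
proof -
  have p: "prob_on K \<mu>" "prob_on K \<nu>" using \<mu> \<nu> by (auto simp: energy_minimiser_def)
  define E where "E = mutual_energy D \<mu> \<mu>"
  have E: "mutual_energy D \<nu> \<nu> = E" "E < \<infinity>"
    using \<mu> \<nu> by (auto simp: energy_minimiser_def E_def intro: antisym)
  have E12: "E \<le> mutual_energy D \<mu> \<nu>"
    unfolding E_def using energy_minimiser_mutual_energy_ge[OF compact_imp_closed[OF K] \<mu> p(2)] E by simp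
  define q where "q \<rho> \<sigma> t = (gauss_energy t \<rho> \<sigma> - exp (- t * D\<^sup>2)) / (2 * t)" for \<rho> \<sigma> t
  have [measurable]: "q \<rho> \<sigma> \<in> borel_measurable borel" if "prob_on K \<rho>" "prob_on K \<sigma>" for \<rho> \<sigma>
    using mutual_energy_gauss(3)[OF that K D] unfolding q_def by measurable
  note [measurable] = this[OF p(1) p(1)] this[OF p(1) p(2)] this[OF p(2) p(2)]
  have q0: "0 \<le> q \<rho> \<sigma> t" if "prob_on K \<rho>" "prob_on K \<sigma>" "t > 0" for \<rho> \<sigma> t
    using mutual_energy_gauss(2)[OF that(1,2) K D that(3)] that(3) by (simp add: q_def)
  have me: "mutual_energy D \<rho> \<sigma> = (\<integral>\<^sup>+ t. ennreal (q \<rho> \<sigma> t) * indicator {0<..} t \<partial>lborel)"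
    if "prob_on K \<rho>" "prob_on K \<sigma>" for \<rho> \<sigma>
    unfolding q_def by (rule mutual_energy_gauss(1)[OF that K D])
  \<comment> \<open>The energy of the difference of the two measures at scale t. Its integral is
    computed below by adding twice the mutual energy, since subtraction in \<open>ennreal\<close>
    truncates; finiteness of E permits the final cancellation.\<close>
  define \<Delta> where "\<Delta> t = q \<mu> \<mu> t + q \<nu> \<nu> t - 2 * q \<mu> \<nu> t" for t
  have [measurable]: "\<Delta> \<in> borel_measurable borel" unfolding \<Delta>_def by measurable
  have \<Delta>: "\<Delta> t = (gauss_energy t \<mu> \<mu> + gauss_energy t \<nu> \<nu> - 2 * gauss_energy t \<mu> \<nu>) / (2 * t)" for t
    by (simp add: \<Delta>_def q_def diff_divide_distrib add_divide_distrib)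
  have \<Delta>0: "\<Delta> t \<ge> 0" if "t > 0" for t
  proof -
    have "0 \<le> (gauss_moment t \<mu> 0 0 - gauss_moment t \<nu> 0 0)\<^sup>2" by simp
    also have "\<dots> \<le> gauss_energy t \<mu> \<mu> + gauss_energy t \<nu> \<nu> - 2 * gauss_energy t \<mu> \<nu>"
      using gauss_energy_diff_ge[OF p K that, of 0 0] by simp
    finally show ?thesis unfolding \<Delta> using that by simp
  qed
  have "(\<integral>\<^sup>+ t. ennreal (\<Delta> t) * indicator {0<..} t \<partial>lborel) + 2 * mutual_energy D \<mu> \<nu> =
     (\<integral>\<^sup>+ t. ennreal (\<Delta> t) * indicator {0<..} t + 2 * (ennreal (q \<mu> \<nu> t) * indicator {0<..} t) \<partial>lborel)"
    unfolding me[OF p] by (simp add: nn_integral_add nn_integral_cmult)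
  also have "\<dots> = (\<integral>\<^sup>+ t. ennreal (q \<mu> \<mu> t) * indicator {0<..} t + ennreal (q \<nu> \<nu> t) * indicator {0<..} t \<partial>lborel)"
  proof (rule nn_integral_cong)
    fix t :: real
    have "ennreal (\<Delta> t) + 2 * ennreal (q \<mu> \<nu> t) = ennreal (q \<mu> \<mu> t) + ennreal (q \<nu> \<nu> t)" if "t > 0"
    proof -
      have "ennreal (\<Delta> t) + 2 * ennreal (q \<mu> \<nu> t) = ennreal (\<Delta> t + 2 * q \<mu> \<nu> t)"
        using \<Delta>0[OF that] q0[OF p that] by (simp add: ennreal_plus ennreal_mult' )
      also have "\<dots> = ennreal (q \<mu> \<mu> t) + ennreal (q \<nu> \<nu> t)"
        using q0[OF p(1) p(1) that] q0[OF p(2) p(2) that] by (simp add: \<Delta>_def ennreal_plus)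
      finally show ?thesis .
    qed
    then show "ennreal (\<Delta> t) * indicator {0<..} t + 2 * (ennreal (q \<mu> \<nu> t) * indicator {0<..} t) =
        ennreal (q \<mu> \<mu> t) * indicator {0<..} t + ennreal (q \<nu> \<nu> t) * indicator {0<..} t"
      by (simp split: split_indicator)
  qed
  also have "\<dots> = 2 * E"
    using E me[OF p(1) p(1)] me[OF p(2) p(2)] by (simp add: nn_integral_add E_def mult_2)
  finally have "(\<integral>\<^sup>+ t. ennreal (\<Delta> t) * indicator {0<..} t \<partial>lborel) + 2 * mutual_energy D \<mu> \<nu> = 2 * E" .
  moreover have "2 * E \<le> 2 * mutual_energy D \<mu> \<nu>" using E12 by (rule mult_left_mono) simp
  moreover have "2 * E < \<infinity>" using E by (simp add: ennreal_mult_less_top)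
  ultimately have "(\<integral>\<^sup>+ t. ennreal (\<Delta> t) * indicator {0<..} t \<partial>lborel) = 0"
    by (rule ennreal_add_eq_le_imp_0)
  then have "AE t in lborel. ennreal (\<Delta> t) * indicator {0<..} t = 0"
    by (subst (asm) nn_integral_0_iff_AE) auto
  then have AE: "AE t in lborel. t > 0 \<longrightarrow> \<Delta> t = 0"
    by eventually_elim (use \<Delta>0 in \<open>force simp: ennreal_eq_0_iff split: split_indicator_asm\<close>)
  obtain t where t: "t > 0" "\<Delta> t = 0"
  proof (rule ccontr)
    assume "\<not> thesis"
    then have "AE t in lborel. \<not> (t::real) > 0" using AE that by (auto elim!: eventually_mono)
    then have "emeasure lborel {0<..<1::real} = 0"
      by (subst AE_iff_measurable[of _ lborel "\<lambda>t. \<not> t \<in> {0<..<1::real}", symmetric])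
        (auto elim!: eventually_mono)
    then show False by simp
  qed
  show ?thesis
  proof (rule prob_on_eqI_gauss_moments[OF p K t(1)])
    fix k l
    have "(2*t)^k / fact k * ((2*t)^l / fact l) * (gauss_moment t \<mu> k l - gauss_moment t \<nu> k l)\<^sup>2 \<le> 0"
      using gauss_energy_diff_ge[OF p K t(1), of k l] t unfolding \<Delta> by simp
    moreover have "0 < (2*t)^k / fact k * ((2*t)^l / fact l)" using t(1) by simp
    ultimately have "(gauss_moment t \<mu> k l - gauss_moment t \<nu> k l)\<^sup>2 \<le> 0"
      by (meson mult_pos_pos not_le)
    then show "gauss_moment t \<mu> k l = gauss_moment t \<nu> k l" by simp
  qed
qed

section \<open>A minimum principle for logarithmic potentials\<close>

text \<open>The four factors multiply to a^4 - s^4: the second-order terms cancel, as harmonicity of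
  ln |a| predicts, and ln(1 + x) \<le> x bounds the remaining fourth-order excess.\<close>

lemma sum_ln_four_points_le:
  assumes d: "0 < s" "s < d" "d \<le> cmod a"
  shows "ln (cmod (a + of_real s)) + ln (cmod (a - of_real s)) + ln (cmod (a + \<i> * of_real s))
     + ln (cmod (a - \<i> * of_real s)) \<le> 4 * ln (cmod a) + s ^ 4 / d ^ 4"
proof -
  have a: "cmod a > 0" using d by linarith
  have n: "cmod (of_real s) < cmod a" "cmod (\<i> * of_real s) < cmod a"
    using d by (auto simp: norm_mult)
  have ne: "a + x \<noteq> 0" "a - x \<noteq> 0" if "cmod x < cmod a" for x
    using that by (auto simp: add_eq_0_iff)
  note ne = ne[OF n(1)] ne[OF n(2)]
  have "ln (cmod (a + of_real s)) + ln (cmod (a - of_real s)) + ln (cmod (a + \<i> * of_real s))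
     + ln (cmod (a - \<i> * of_real s)) = ln (cmod (a + of_real s) * cmod (a - of_real s) * cmod (a + \<i> * of_real s)
     * cmod (a - \<i> * of_real s))"
    using ne by (simp add: ln_mult)
  also have "cmod (a + of_real s) * cmod (a - of_real s) * cmod (a + \<i> * of_real s)
     * cmod (a - \<i> * of_real s) = cmod (a ^ 4 - of_real s ^ 4)"
    unfolding norm_mult[symmetric]
    by (rule arg_cong[where f=cmod]) (simp add: algebra_simps power4_eq_xxxx)
  also have "ln (cmod (a ^ 4 - of_real s ^ 4)) \<le> ln (cmod a ^ 4 * (1 + (s / cmod a) ^ 4))"
  proof (rule ln_mono)
    have "a ^ 4 - of_real s ^ 4 = (a + of_real s) * (a - of_real s) * (a + \<i> * of_real s) * (a - \<i> * of_real s)"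
      by (simp add: algebra_simps power4_eq_xxxx)
    then show "0 < cmod (a ^ 4 - of_real s ^ 4)" using ne by simp
    have "cmod (a ^ 4 - of_real s ^ 4) \<le> cmod a ^ 4 + s ^ 4"
      using norm_triangle_ineq4[of "a ^ 4" "of_real s ^ 4"] d by (simp add: norm_power)
    then show "cmod (a ^ 4 - of_real s ^ 4) \<le> cmod a ^ 4 * (1 + (s / cmod a) ^ 4)"
      using a by (simp add: distrib_left power_divide)
  qed
  also have "\<dots> = 4 * ln (cmod a) + ln (1 + (s / cmod a) ^ 4)"
  proof -
    have "1 + (s / cmod a) ^ 4 > 0" by (rule add_pos_nonneg) auto
    then show ?thesis using a by (subst ln_mult) (auto simp: ln_realpow)
  qed
  also have "ln (1 + (s / cmod a) ^ 4) \<le> (s / cmod a) ^ 4"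
    by (rule ln_add_one_self_le_self) simp
  also have "\<dots> \<le> s ^ 4 / d ^ 4"
    using d a unfolding power_divide by (intro divide_left_mono power_mono mult_pos_pos) auto
  finally show ?thesis by simp
qed

text \<open>Comparing a point with its nearest neighbour on the carrier makes \<open>max 0 (V - p)\<close> continuous; off the carrier the
  sum of \<open>p\<close> over the vertices of a small square exceeds four times the value at the centre by at most
  a fourth-order term, which the perturbation \<open>\<epsilon> |z|\<^sup>2\<close> beats at an interior maximum.\<close>
lemma log_potential_minimum_principle:
  fixes \<mu> :: "complex measure" and S :: "complex set" and V :: real
  defines "p \<equiv> \<lambda>z. \<integral>w. ln (cmod (z - w)) \<partial>\<mu>"
  assumes ps: "prob_space \<mu>" and sets: "sets \<mu> = sets borel"
    and S: "compact S" "AE w in \<mu>. w \<in> S"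
    and int: "\<And>z. integrable \<mu> (\<lambda>w. ln (cmod (z - w)))"
    and atom: "\<And>z. emeasure \<mu> {z} = 0"
    and V: "\<And>z. z \<in> S \<Longrightarrow> V \<le> p z"
  shows "V \<le> p z"
proof -
  interpret prob_space \<mu> by fact
  note sets[measurable_cong]
  have sp: "space \<mu> = UNIV" using sets_eq_imp_space_eq[OF sets] by simp
  have AEne: "AE w in \<mu>. w \<noteq> z" for z
    using atom[of z] by (intro AE_I[where N="{z}"]) (auto simp: sets)
  have Sne: "S \<noteq> {}"
  proof
    assume "S = {}"
    then have "AE w in \<mu>. False" using S(2) by simp
    then show False by simp
  qed
  have ln_diff: "ln x - ln y \<le> (x - y) / y" if "x > 0" "y > 0" for x y :: real
    using ln_le_minus_one[of "x / y"] that by (simp add: ln_div diff_divide_distrib)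
  have off: "\<exists>d>0. \<forall>w\<in>S. d \<le> cmod (z - w)" if "z \<notin> S" for z
  proof -
    have "infdist z S > 0"
      using that compact_imp_closed[OF S(1)] Sne infdist_nonneg[of z S]
      by (metis in_closed_iff_infdist_zero less_eq_real_def)
    moreover have "infdist z S \<le> cmod (z - w)" if "w \<in> S" for w
      using infdist_le[OF that, of z] by (simp add: dist_norm)
    ultimately show ?thesis by blast
  qed
  \<comment> \<open>It vanishes on S and far from the origin, so a positive value would produce an
    interior maximum off S.\<close>
  define f where "f z = max 0 (V - p z)" for z
  have cont: "continuous_on UNIV f"
    unfolding continuous_on_eq_continuous_at[OF open_UNIV]
  proof
    fix \<zeta> :: complex
    show "isCont f \<zeta>"
    proof (cases "\<zeta> \<in> S")
      case False
      then obtain d where d: "d > 0" "\<And>w. w \<in> S \<Longrightarrow> d \<le> cmod (\<zeta> - w)" using off by blast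
      have lip: "\<bar>p z - p \<zeta>\<bar> \<le> (2 / d) * cmod (z - \<zeta>)" if z: "cmod (z - \<zeta>) < d / 2" for z
      proof -
        have "\<bar>\<integral>w. ln (cmod (z - w)) - ln (cmod (\<zeta> - w)) \<partial>\<mu>\<bar> \<le>
            (\<integral>w. \<bar>ln (cmod (z - w)) - ln (cmod (\<zeta> - w))\<bar> \<partial>\<mu>)"
          by (rule integral_abs_bound)
        also have "\<dots> \<le> (\<integral>w. (2 / d) * cmod (z - \<zeta>) \<partial>\<mu>)"
        proof (rule integral_mono_AE)
          show "AE w in \<mu>. \<bar>ln (cmod (z - w)) - ln (cmod (\<zeta> - w))\<bar> \<le> (2 / d) * cmod (z - \<zeta>)"
            using S(2)
          proof eventually_elim
            case (elim w)
            have b: "\<bar>cmod (z - w) - cmod (\<zeta> - w)\<bar> \<le> cmod (z - \<zeta>)"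
              using norm_triangle_ineq3[of "z - w" "\<zeta> - w"] by simp
            then have c: "cmod (z - w) \<ge> d / 2" "cmod (\<zeta> - w) \<ge> d / 2"
              using d(2)[OF elim] z d(1) by auto
            have "ln x - ln y \<le> (2 / d) * cmod (z - \<zeta>)" if "x \<ge> d / 2" "y \<ge> d / 2" "\<bar>x - y\<bar> \<le> cmod (z - \<zeta>)" for x y
            proof -
              have "ln x - ln y \<le> (x - y) / y" using that d(1) by (intro ln_diff) auto
              also have "\<dots> \<le> cmod (z - \<zeta>) / (d / 2)"
                using that d(1) by (intro frac_le) auto
              finally show ?thesis by (simp add: mult.commute)
            qed
            from this[OF c b] this[OF c(2,1)] b show ?case by (auto simp: abs_le_iff abs_minus_commute)
          qed
        qed (use int in simp_all)
        finally show ?thesis using int by (simp add: p_def prob_space)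
      qed
      have "(p \<longlongrightarrow> p \<zeta>) (at \<zeta>)"
      proof (rule LIM_zero_cancel, rule Lim_null_comparison)
        have "\<forall>\<^sub>F z in at \<zeta>. dist z \<zeta> < d / 2"
          using d(1) by (auto simp: eventually_at intro!: exI[where x="d/2"])
        then show "\<forall>\<^sub>F z in at \<zeta>. norm (p z - p \<zeta>) \<le> (2 / d) * cmod (z - \<zeta>)"
          by eventually_elim (use lip in \<open>simp add: dist_norm\<close>)
        have "((\<lambda>z. (2 / d) * cmod (z - \<zeta>)) \<longlongrightarrow> (2 / d) * cmod (\<zeta> - \<zeta>)) (at \<zeta>)"
          by (intro tendsto_intros)
        then show "((\<lambda>z. (2 / d) * cmod (z - \<zeta>)) \<longlongrightarrow> 0) (at \<zeta>)" by simp
      qed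
      then show ?thesis unfolding f_def isCont_def by (intro tendsto_intros)
    next
      case True
      then have f0: "f \<zeta> = 0" using V by (simp add: f_def)
      have near: "\<exists>\<delta>>0. \<forall>z. cmod (z - \<zeta>) < \<delta> \<longrightarrow> V - p z \<le> \<eta>" if \<eta>: "\<eta> > 0" for \<eta>
      proof -
        have "(\<lambda>n. measure \<mu> (ball \<zeta> (1 / real (Suc n)))) \<longlonglongrightarrow> measure \<mu> (\<Inter>n. ball \<zeta> (1 / real (Suc n)))"
        proof (rule finite_Lim_measure_decseq)
          show "range (\<lambda>n. ball \<zeta> (1 / real (Suc n))) \<subseteq> sets \<mu>" by (auto simp: sets)
          show "decseq (\<lambda>n. ball \<zeta> (1 / real (Suc n)))"
            by (intro decseq_SucI subset_ball) (simp add: field_simps)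
        qed
        also have "(\<Inter>n. ball \<zeta> (1 / real (Suc n))) = {\<zeta>}"
        proof -
          have "x = \<zeta>" if "\<And>n. dist \<zeta> x < 1 / real (Suc n)" for x
          proof (rule ccontr)
            assume "x \<noteq> \<zeta>"
            then obtain n where "1 / real (Suc n) < dist \<zeta> x"
              using reals_Archimedean[of "dist \<zeta> x"] by (auto simp: inverse_eq_divide)
            then show False using that[of n] by simp
          qed
          then show ?thesis by auto
        qed
        also have "measure \<mu> {\<zeta>} = 0" using atom[of \<zeta>] by (simp add: measure_def)
        finally have "\<forall>\<^sub>F n in sequentially. measure \<mu> (ball \<zeta> (1 / real (Suc n))) < \<eta> / 2"
          using \<eta> by (intro order_tendstoD) auto
        then obtain n where n: "measure \<mu> (ball \<zeta> (1 / real (Suc n))) < \<eta> / 2"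
          by (auto simp: eventually_sequentially)
        define r where "r = 1 / real (Suc n)"
        have r: "r > 0" "measure \<mu> (ball \<zeta> r) < \<eta> / 2" using n by (auto simp: r_def)
        \<comment> \<open>The bound r / 2 keeps z at distance at least r / 2 from every point
          outside the ball; the bound \<eta> r / 4 makes the resulting error (2 / r) \<delta> at
          most \<eta> / 2.\<close>
        define \<delta> where "\<delta> = min (r / 2) (\<eta> * r / 4)"
        have \<delta>: "\<delta> > 0" "\<delta> \<le> r / 2" "(2 / r) * \<delta> \<le> \<eta> / 2"
          using r \<eta> by (auto simp: \<delta>_def min_def field_simps)
        have ib: "integrable \<mu> (\<lambda>u. indicator (ball \<zeta> r) u :: real)"
          by (rule integrable_const_bound[where B=1]) (auto split: split_indicator intro!: borel_measurable_indicator simp: sets)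
        have "V - p z \<le> \<eta>" if z: "cmod (z - \<zeta>) < \<delta>" for z
        proof -
          \<comment> \<open>For u in S, |v - u| \<le> |v - z| + |z - u| \<le> 2 |z - u|. This costs
            ln 2, but it is charged only on the ball, whose mass is below \<eta> / 2; outside the
            ball the ratio of the distances is close to 1.\<close>
          obtain v where v: "v \<in> S" "\<And>u. u \<in> S \<Longrightarrow> dist z v \<le> dist z u"
            using distance_attains_inf[OF compact_imp_closed[OF S(1)] Sne, of z] by blast
          have vz: "cmod (v - z) < \<delta>"
            using v(2)[OF True] z by (simp add: dist_norm norm_minus_commute)
          have "p v - ln 2 * measure \<mu> (ball \<zeta> r) - (2 / r) * \<delta> =
              (\<integral>u. ln (cmod (v - u)) - ln 2 * indicator (ball \<zeta> r) u - (2 / r) * \<delta> \<partial>\<mu>)"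
            using int[of v] ib prob_space by (simp add: p_def sp)
          also have "\<dots> \<le> p z" unfolding p_def
          proof (rule integral_mono_AE)
            show "AE u in \<mu>. ln (cmod (v - u)) - ln 2 * indicator (ball \<zeta> r) u - 2 / r * \<delta> \<le> ln (cmod (z - u))"
              using S(2) AEne[of v] AEne[of z]
            proof eventually_elim
              case (elim u)
              have nz: "cmod (v - u) > 0" "cmod (z - u) > 0" using elim by auto
              have rp: "(2 / r) * \<delta> \<ge> 0" using r \<delta> by simp
              show ?case
              proof (cases "u \<in> ball \<zeta> r")
                case True
                have "cmod (v - u) \<le> cmod (v - z) + cmod (z - u)"
                  using norm_triangle_ineq[of "v - z" "z - u"] by simp
                also have "cmod (v - z) \<le> cmod (z - u)"
                  using v(2)[OF elim(1)] by (simp add: dist_norm norm_minus_commute)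
                finally have "ln (cmod (v - u)) \<le> ln (2 * cmod (z - u))" using nz by (intro ln_mono) auto
                then show ?thesis using True rp nz by (simp add: ln_mult)
              next
                case False
                then have "r \<le> cmod (\<zeta> - u)" by (simp add: dist_norm)
                also have "\<dots> \<le> cmod (z - \<zeta>) + cmod (z - u)"
                  using norm_triangle_ineq4[of "z - u" "z - \<zeta>"] by simp
                finally have zu: "r / 2 \<le> cmod (z - u)" using z \<delta> by simp
                have "ln (cmod (v - u)) - ln (cmod (z - u)) \<le> (cmod (v - u) - cmod (z - u)) / cmod (z - u)"
                  by (rule ln_diff[OF nz])
                also have "\<dots> \<le> \<delta> / (r / 2)"
                proof (rule frac_le)
                  show "cmod (v - u) - cmod (z - u) \<le> \<delta>"
                    using norm_triangle_ineq2[of "v - u" "z - u"] vz by simp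
                qed (use zu r \<delta> in auto)
                finally show ?thesis using False by simp
              qed
            qed
          qed (use int ib in simp_all)
          finally have "p v - ln 2 * measure \<mu> (ball \<zeta> r) - (2 / r) * \<delta> \<le> p z" .
          moreover have "ln 2 * measure \<mu> (ball \<zeta> r) \<le> 1 * (\<eta> / 2)"
            using ln_2_less_1 r(2) by (intro mult_mono) auto
          ultimately show ?thesis using V[OF v(1)] \<delta>(3) by linarith
        qed
        then show ?thesis using \<delta>(1) by blast
      qed
      show ?thesis
        unfolding continuous_at_eps_delta
      proof (intro allI impI)
        fix e :: real assume "e > 0"
        then obtain \<delta> where \<delta>: "\<delta> > 0" "\<And>z. cmod (z - \<zeta>) < \<delta> \<Longrightarrow> V - p z \<le> e / 2"
          using near[of "e / 2"] by auto
        have "dist (f x') (f \<zeta>) < e" if "dist x' \<zeta> < \<delta>" for x'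
          using \<delta>(2)[of x'] that \<open>e > 0\<close> unfolding f0 by (auto simp: dist_norm f_def max_def)
        then show "\<exists>d>0. \<forall>x'. dist x' \<zeta> < d \<longrightarrow> dist (f x') (f \<zeta>) < e"
          using \<delta>(1) by blast
      qed
    qed
  qed
  obtain R1 where R1: "R1 > 0" "\<And>w. w \<in> S \<Longrightarrow> cmod w \<le> R1"
    using compact_imp_bounded[OF S(1)] by (auto simp: bounded_pos)
  \<comment> \<open>If |z| \<ge> R, all points of S are at distance at least exp V from z, so the
    potential there is at least V.\<close>
  define R where "R = R1 + exp V"
  have R: "R > 0" using R1 by (simp add: R_def add_pos_pos)
  have far: "f z = 0" if "cmod z \<ge> R" for z
  proof -
    have "V = (\<integral>w. V \<partial>\<mu>)" by (simp add: prob_space)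
    also have "\<dots> \<le> p z" unfolding p_def
    proof (rule integral_mono_AE)
      show "AE w in \<mu>. V \<le> ln (cmod (z - w))" using S(2)
      proof eventually_elim
        case (elim w)
        have "exp V \<le> cmod (z - w)"
          using R1(2)[OF elim] that norm_triangle_ineq2[of z w] by (simp add: R_def)
        then show ?case by (meson exp_gt_zero ln_ge_iff order.strict_trans2)
      qed
    qed (use int in simp_all)
    finally show ?thesis by (simp add: f_def)
  qed
  show ?thesis
  proof (rule ccontr)
    assume "\<not> V \<le> p z"
    then have fz: "f z > 0" by (simp add: f_def)
    \<comment> \<open>On the disc of radius R the perturbation is then at most half of f z, so f
      stays positive at the maximum of h.\<close>
    define \<epsilon> where "\<epsilon> = f z / (2 * R\<^sup>2)"
    have \<epsilon>: "\<epsilon> > 0" using fz R by (simp add: \<epsilon>_def)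
    define h where "h x = f x + \<epsilon> * (cmod x)\<^sup>2" for x
    have "continuous_on (cball 0 R) h"
      unfolding h_def using continuous_on_subset[OF cont] by (intro continuous_intros) auto
    then obtain z0 where z0: "z0 \<in> cball 0 R" "\<And>x. x \<in> cball 0 R \<Longrightarrow> h x \<le> h z0"
      using continuous_attains_sup[of "cball 0 R" h] R by auto
    have "z \<in> cball 0 R" using far[of z] fz by (cases "cmod z \<ge> R") auto
    then have "f z + \<epsilon> * (cmod z)\<^sup>2 \<le> f z0 + \<epsilon> * (cmod z0)\<^sup>2" using z0(2)[of z] by (simp add: h_def)
    moreover have "\<epsilon> * (cmod z0)\<^sup>2 \<le> \<epsilon> * R\<^sup>2"
      using z0(1) \<epsilon> by (intro mult_left_mono power_mono) auto
    moreover have "\<epsilon> * R\<^sup>2 = f z / 2" using R by (simp add: \<epsilon>_def)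
    moreover have "\<epsilon> * (cmod z)\<^sup>2 \<ge> 0" using \<epsilon> by simp
    ultimately have fz0: "f z0 > 0" using fz by linarith
    then have fz0': "f z0 = V - p z0" "V > p z0" by (auto simp: f_def max_def split: if_splits)
    have z0R: "cmod z0 < R" using far[of z0] fz0 by (cases "cmod z0 \<ge> R") auto
    have "z0 \<notin> S" using V[of z0] fz0' by auto
    then obtain d where d: "d > 0" "\<And>w. w \<in> S \<Longrightarrow> d \<le> cmod (z0 - w)" using off by blast
    \<comment> \<open>The three bounds serve, in order, the four-point estimate with s < d, keeping
      the vertices in the disc where h is maximal at z0, and s^4 / d^4 \<le> \<epsilon> s^2.\<close>
    define s where "s = min (min (d / 2) (R - cmod z0)) (d\<^sup>2 * sqrt \<epsilon>)"
    have s: "0 < s" "s < d" "s \<le> R - cmod z0" "s \<le> d\<^sup>2 * sqrt \<epsilon>"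
      using d(1) z0R \<epsilon> by (auto simp: s_def)
    have "s\<^sup>2 \<le> (d\<^sup>2 * sqrt \<epsilon>)\<^sup>2" using s by (intro power_mono) auto
    also have "\<dots> = d ^ 4 * \<epsilon>" using \<epsilon> by (simp add: power_mult_distrib flip: power_mult)
    finally have "s\<^sup>2 / d ^ 4 \<le> \<epsilon>" using d(1) by (simp add: field_simps)
    then have "s\<^sup>2 * (s\<^sup>2 / d ^ 4) \<le> s\<^sup>2 * \<epsilon>" by (rule mult_left_mono) simp
    then have s4: "s ^ 4 / d ^ 4 \<le> \<epsilon> * s\<^sup>2" by (simp add: mult.commute flip: power_add)
    have "p (z0 + s) + p (z0 - s) + p (z0 + \<i> * s) + p (z0 - \<i> * s) =
      (\<integral>w. ln (cmod (z0 + s - w)) + ln (cmod (z0 - s - w)) + ln (cmod (z0 + \<i> * s - w)) + ln (cmod (z0 - \<i> * s - w)) \<partial>\<mu>)"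
      unfolding p_def using int by simp
    also have "\<dots> \<le> (\<integral>w. 4 * ln (cmod (z0 - w)) + s ^ 4 / d ^ 4 \<partial>\<mu>)"
    proof (rule integral_mono_AE)
      show "AE w in \<mu>. ln (cmod (z0 + s - w)) + ln (cmod (z0 - s - w)) + ln (cmod (z0 + \<i> * s - w)) + ln (cmod (z0 - \<i> * s - w))
        \<le> 4 * ln (cmod (z0 - w)) + s ^ 4 / d ^ 4" using S(2)
      proof eventually_elim
        case (elim w)
        then show ?case
          using sum_ln_four_points_le[OF s(1,2) d(2)[OF elim]] by (simp add: algebra_simps)
      qed
    qed (use int in simp_all)
    also have "\<dots> = 4 * p z0 + s ^ 4 / d ^ 4" using int by (simp add: p_def prob_space)
    finally have P: "p (z0 + s) + p (z0 - s) + p (z0 + \<i> * s) + p (z0 - \<i> * s) \<le> 4 * p z0 + s ^ 4 / d ^ 4" .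
    have hle: "V - p x + \<epsilon> * (cmod x)\<^sup>2 \<le> h z0" if "cmod (x - z0) = s" for x
    proof -
      have "cmod x \<le> R" using that s(3) norm_triangle_ineq2[of x z0] by simp
      then have "h x \<le> h z0" using z0(2) by simp
      then show ?thesis by (simp add: h_def f_def)
    qed
    \<comment> \<open>Summed over the four vertices, the quadratic term gains 4 \<epsilon> s^2 over
      the centre, while V - p loses at most \<epsilon> s^2; this contradicts maximality at
      z0.\<close>
    have "4 * h z0 \<ge> 4 * V - (p (z0 + s) + p (z0 - s) + p (z0 + \<i> * s) + p (z0 - \<i> * s)) +
        \<epsilon> * ((cmod (z0 + s))\<^sup>2 + (cmod (z0 - s))\<^sup>2 + (cmod (z0 + \<i> * s))\<^sup>2 + (cmod (z0 - \<i> * s))\<^sup>2)"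
      using hle[of "z0 + s"] hle[of "z0 - s"] hle[of "z0 + \<i> * s"] hle[of "z0 - \<i> * s"] s(1)
      by (simp add: norm_mult algebra_simps)
    also have "(cmod (z0 + s))\<^sup>2 + (cmod (z0 - s))\<^sup>2 + (cmod (z0 + \<i> * s))\<^sup>2 + (cmod (z0 - \<i> * s))\<^sup>2 = 4 * (cmod z0)\<^sup>2 + 4 * s\<^sup>2"
      unfolding cmod_power2 by (simp add: power2_eq_square algebra_simps)
    finally have "4 * h z0 \<ge> 4 * V - (4 * p z0 + s ^ 4 / d ^ 4) + \<epsilon> * (4 * (cmod z0)\<^sup>2 + 4 * s\<^sup>2)"
      using P by linarith
    then have "4 * \<epsilon> * s\<^sup>2 \<le> s ^ 4 / d ^ 4" using fz0' by (simp add: h_def algebra_simps)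
    then have "4 * (\<epsilon> * s\<^sup>2) \<le> 1 * (\<epsilon> * s\<^sup>2)" using s4 by simp
    moreover have "\<epsilon> * s\<^sup>2 > 0" using \<epsilon> s(1) by simp
    ultimately show False by simp
  qed
qed

section \<open>Frostman's theorem\<close>

text \<open>The first variation forbids a potential below E on a set of positive mass; since its
  \<mu>-mean is exactly E, it cannot exceed E on such a set either.\<close>

lemma energy_minimiser_log_pot_AE:
  assumes K: "closed K" and \<mu>: "energy_minimiser D K \<mu>"
  shows "AE z in \<mu>. log_pot D \<mu> z \<le> mutual_energy D \<mu> \<mu>"
proof -
  define E where "E = mutual_energy D \<mu> \<mu>"
  have E: "E < \<infinity>" using \<mu> by (simp add: energy_minimiser_def E_def)
  have p: "prob_on K \<mu>" using \<mu> by (simp add: energy_minimiser_def)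
  then have ps: "prob_space \<mu>" and sets[measurable_cong]: "sets \<mu> = sets borel"
    by (auto simp: prob_on_def)
  interpret prob_space \<mu> by fact
  have U[measurable]: "log_pot D \<mu> \<in> borel_measurable borel" by (rule measurable_log_pot[OF ps sets])
  have EU: "(\<integral>\<^sup>+ z. log_pot D \<mu> z \<partial>\<mu>) = E" by (simp add: E_def mutual_energy_def)
  have sp: "space \<mu> = UNIV" using sets_eq_imp_space_eq[OF sets] by simp
  define B where "B = {z. log_pot D \<mu> z < E}"
  have B: "B \<in> sets borel" unfolding B_def by measurable
  \<comment> \<open>Otherwise the normalised restriction of \<open>\<mu>\<close> to \<open>B\<close> has mutual energy below \<open>E\<close> with \<open>\<mu>\<close>.\<close>
  have "emeasure \<mu> B = 0"
  proof (rule ccontr)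
    assume mB: "emeasure \<mu> B \<noteq> 0"
    define \<nu> where "\<nu> = uniform_measure \<mu> B"
    have fin: "emeasure \<mu> B \<noteq> \<infinity>" by simp
    have B': "B \<in> sets \<mu>" using B sets by simp
    have \<nu>ps: "prob_space \<nu>" unfolding \<nu>_def by (rule prob_space_uniform_measure[OF mB fin])
    interpret \<nu>: prob_space \<nu> by fact
    have \<nu>s[measurable_cong]: "sets \<nu> = sets borel" by (simp add: \<nu>_def sets)
    have \<nu>B: "AE z in \<nu>. log_pot D \<mu> z < E"
      unfolding \<nu>_def by (rule AE_uniform_measureI[OF B']) (simp add: B_def)
    have \<nu>K: "prob_on K \<nu>"
    proof (rule prob_onI[OF \<nu>ps \<nu>s K])
      show "AE z in \<nu>. z \<in> K"
        unfolding \<nu>_def using prob_on_AE[OF p K] by (intro AE_uniform_measureI[OF B']) auto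
    qed
    have le: "(\<integral>\<^sup>+ z. f z \<partial>\<nu>) \<le> (\<integral>\<^sup>+ z. f z \<partial>\<mu>) / emeasure \<mu> B"
      if [measurable]: "f \<in> borel_measurable borel" for f
      unfolding \<nu>_def using B'
      by (subst nn_integral_uniform_measure)
        (auto intro!: divide_right_mono_ennreal nn_integral_mono split: split_indicator)
    have pot: "log_pot D \<nu> z \<le> log_pot D \<mu> z / emeasure \<mu> B" for z
      unfolding log_pot_def by (rule le) measurable
    \<comment> \<open>Restriction raises the density by at most 1 / \<mu>(B), so the energy of
      \<open>\<nu>\<close> is at most E / \<mu>(B)^2. This finiteness admits \<open>\<nu>\<close> as
      a test measure.\<close>
    have "mutual_energy D \<nu> \<nu> \<le> (\<integral>\<^sup>+ z. log_pot D \<mu> z / emeasure \<mu> B \<partial>\<nu>)"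
      unfolding mutual_energy_def by (intro nn_integral_mono pot)
    also have "\<dots> \<le> (\<integral>\<^sup>+ z. log_pot D \<mu> z / emeasure \<mu> B \<partial>\<mu>) / emeasure \<mu> B"
      by (rule le) measurable
    also have "\<dots> = E / emeasure \<mu> B / emeasure \<mu> B"
      by (simp add: nn_integral_divide EU)
    also have "\<dots> < \<infinity>"
      using E mB by (simp add: ennreal_divide_eq_top_iff less_top[symmetric])
    finally have "E \<le> mutual_energy D \<mu> \<nu>"
      unfolding E_def by (intro energy_minimiser_mutual_energy_ge[OF K \<mu> \<nu>K])
    also have "\<dots> = (\<integral>\<^sup>+ z. log_pot D \<mu> z \<partial>\<nu>)"
      using mutual_energy_commute[OF ps sets \<nu>ps \<nu>s] by (simp add: mutual_energy_def)
    also have "\<dots> < (\<integral>\<^sup>+ z. E \<partial>\<nu>)"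
    proof (rule nn_integral_less)
      have "(\<integral>\<^sup>+ z. log_pot D \<mu> z \<partial>\<nu>) \<le> (\<integral>\<^sup>+ z. E \<partial>\<nu>)"
        by (rule nn_integral_mono_AE) (use \<nu>B in \<open>auto elim!: eventually_mono\<close>)
      also have "\<dots> = E" by (simp add: \<nu>.emeasure_space_1)
      finally show "(\<integral>\<^sup>+ z. log_pot D \<mu> z \<partial>\<nu>) \<noteq> \<infinity>" using E by auto
      show "AE z in \<nu>. log_pot D \<mu> z \<le> E" using \<nu>B by (auto elim!: eventually_mono)
      show "\<not> (AE z in \<nu>. E \<le> log_pot D \<mu> z)"
      proof
        assume "AE z in \<nu>. E \<le> log_pot D \<mu> z"
        then have "AE z in \<nu>. False" using \<nu>B by eventually_elim auto
        then show False by simp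
      qed
    qed measurable
    also have "\<dots> = E" by (simp add: \<nu>.emeasure_space_1)
    finally show False by simp
  qed
  then have ge: "AE z in \<mu>. E \<le> log_pot D \<mu> z"
    using B sets by (intro AE_I[where N=B]) (auto simp: B_def)
  show ?thesis
  proof (rule ccontr)
    assume "\<not> ?thesis"
    then have "(\<integral>\<^sup>+ z. E \<partial>\<mu>) < (\<integral>\<^sup>+ z. log_pot D \<mu> z \<partial>\<mu>)"
      using ge E by (intro nn_integral_less) (auto simp: emeasure_space_1 E_def)
    then show False by (simp add: EU emeasure_space_1)
  qed
qed

text \<open>At a point of S below, finiteness of \<open>log_pot\<close> gives integrability and
  excludes an atom; off S both follow from the positive distance to S. The set S is compact by
  \<open>log_pot_liminf\<close>, as the minimum principle demands.\<close>

lemma frostman_potential_ge: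
  assumes K: "compact K" and D: "D > 0" "\<And>z. z \<in> K \<Longrightarrow> cmod z \<le> D / 2"
    and \<mu>: "energy_minimiser D K \<mu>"
  shows "integrable \<mu> (\<lambda>w. ln (cmod (z - w)))"
    and "emeasure \<mu> {z} = 0"
    and "ln D - enn2real (mutual_energy D \<mu> \<mu>) \<le> (\<integral>w. ln (cmod (z - w)) \<partial>\<mu>)"
proof -
  define E where "E = mutual_energy D \<mu> \<mu>"
  have E: "E < \<infinity>" using \<mu> by (simp add: energy_minimiser_def E_def)
  have p: "prob_on K \<mu>" using \<mu> by (simp add: energy_minimiser_def)
  then have ps: "prob_space \<mu>" and sets[measurable_cong]: "sets \<mu> = sets borel"
    by (auto simp: prob_on_def)
  interpret prob_space \<mu> by fact
  note cK = compact_imp_closed[OF K]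
  note AEK = prob_on_AE[OF p cK]
  define S where "S = {z. log_pot D \<mu> z \<le> E} \<inter> K"
  have "closed {z. log_pot D \<mu> z \<le> E}"
    unfolding closed_sequential_limits
  proof (intro allI impI)
    fix x l assume x: "(\<forall>n. x n \<in> {z. log_pot D \<mu> z \<le> E}) \<and> x \<longlonglongrightarrow> l"
    have "log_pot D \<mu> l \<le> liminf (\<lambda>n. log_pot D \<mu> (x n))"
      using x by (intro log_pot_liminf D sets) auto
    also have "\<dots> \<le> liminf (\<lambda>n. E)" using x by (intro Liminf_mono) auto
    finally show "l \<in> {z. log_pot D \<mu> z \<le> E}" by (simp add: Liminf_const)
  qed
  then have S: "compact S" unfolding S_def using K by (rule closed_Int_compact)
  have AES: "AE z in \<mu>. z \<in> S"
    using energy_minimiser_log_pot_AE[OF cK \<mu>] AEK by eventually_elim (simp add: S_def E_def)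
  have on: "integrable \<mu> (\<lambda>w. ln (cmod (z - w))) \<and> emeasure \<mu> {z} = 0 \<and>
      ln D - enn2real E \<le> (\<integral>w. ln (cmod (z - w)) \<partial>\<mu>)" if z: "z \<in> S" for z
  proof -
    have U: "log_pot D \<mu> z \<le> E" "z \<in> K" using z by (auto simp: S_def)
    then have fin: "(\<integral>\<^sup>+ w. log_kernel D z w \<partial>\<mu>) \<noteq> \<infinity>" using E by (auto simp: log_pot_def)
    have N: "AE w in \<mu>. w \<noteq> z"
      using nn_integral_noteq_infinite[OF _ fin] by (auto simp: log_kernel_def elim!: eventually_mono)
    have "emeasure \<mu> {z} = 0"
      using N AE_iff_measurable[of "{z}" \<mu> "\<lambda>w. w \<noteq> z"] sets sets_eq_imp_space_eq[OF sets] by auto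
    have pos: "AE w in \<mu>. 0 \<le> ln D - ln (cmod (z - w))"
      using N AEK
    proof eventually_elim
      case (elim w)
      have "cmod (z - w) \<le> D"
        using D(2)[OF U(2)] D(2)[OF elim(2)] norm_triangle_ineq4[of z w] by linarith
      then show ?case using elim D(1) by simp
    qed
    have e: "(\<integral>\<^sup>+ w. ennreal (ln D - ln (cmod (z - w))) \<partial>\<mu>) = log_pot D \<mu> z"
      unfolding log_pot_def by (rule nn_integral_cong_AE)
        (use N D in \<open>auto elim!: eventually_mono simp: log_kernel_def ln_div\<close>)
    have int: "integrable \<mu> (\<lambda>w. ln D - ln (cmod (z - w)))"
      using pos e fin by (intro integrableI_nonneg) (auto simp: less_top log_pot_def)
    have "integrable \<mu> (\<lambda>w. ln D - (ln D - ln (cmod (z - w))))"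
      by (intro Bochner_Integration.integrable_diff int) simp
    then have int': "integrable \<mu> (\<lambda>w. ln (cmod (z - w)))" by simp
    have "ennreal (\<integral>w. ln D - ln (cmod (z - w)) \<partial>\<mu>) \<le> E"
      using nn_integral_eq_integral[OF int pos] e U by simp
    then have "(\<integral>w. ln D - ln (cmod (z - w)) \<partial>\<mu>) \<le> enn2real E"
      using E integral_nonneg_AE[OF pos] enn2real_mono by fastforce
    then show ?thesis using int' \<open>emeasure \<mu> {z} = 0\<close> by (simp add: prob_space)
  qed
  have off: "integrable \<mu> (\<lambda>w. ln (cmod (z - w))) \<and> emeasure \<mu> {z} = 0" if z: "z \<notin> S" for z
  proof
    have "S \<noteq> {}"
    proof
      assume "S = {}"
      then have "AE w in \<mu>. False" using AES by simp
      then show False by simp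
    qed
    then have d: "infdist z S > 0"
      using z compact_imp_closed[OF S] infdist_nonneg[of z S]
      by (metis in_closed_iff_infdist_zero less_eq_real_def)
    have dle: "infdist z S \<le> cmod (z - w)" if "w \<in> S" for w
      using infdist_le[OF that, of z] by (simp add: dist_norm)
    show "integrable \<mu> (\<lambda>w. ln (cmod (z - w)))"
    proof (rule integrable_const_bound)
      show "AE w in \<mu>. norm (ln (cmod (z - w))) \<le> max \<bar>ln (infdist z S)\<bar> \<bar>ln (cmod z + D)\<bar>"
        using AES
      proof eventually_elim
        case (elim w)
        have "cmod w \<le> D" using D(1) D(2)[of w] elim by (simp add: S_def)
        then have u: "cmod (z - w) \<le> cmod z + D" using norm_triangle_ineq4[of z w] by linarith
        have "ln (infdist z S) \<le> ln (cmod (z - w))" "ln (cmod (z - w)) \<le> ln (cmod z + D)"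
          using dle[OF elim] d u by (auto intro!: ln_mono)
        then show ?case by auto
      qed
    qed simp
    have "AE w in \<mu>. w \<noteq> z" using AES by eventually_elim (use z in auto)
    then show "emeasure \<mu> {z} = 0"
      using AE_iff_measurable[of "{z}" \<mu> "\<lambda>w. w \<noteq> z"] sets sets_eq_imp_space_eq[OF sets] by auto
  qed
  show int: "integrable \<mu> (\<lambda>w. ln (cmod (z - w)))" and atom: "emeasure \<mu> {z} = 0" for z
    using on off by blast+
  show "ln D - enn2real (mutual_energy D \<mu> \<mu>) \<le> (\<integral>w. ln (cmod (z - w)) \<partial>\<mu>)"
    unfolding E_def[symmetric]
    by (rule log_potential_minimum_principle[OF ps sets S AES int atom]) (use on in blast)
qed

text \<open>Non-polarity provides a measure of finite mutual energy, hence a minimiser; uniqueness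
  makes the definite description in \<open>equilibrium_measure\<close> denote it, and its energy is
  ln Cap(K).\<close>

lemma equilibrium_measure_properties:
  assumes K: "compact K" and np: "\<not> polar K"
  shows equilibrium_measure_prob_on: "prob_on K (equilibrium_measure K)"
    and log_cap_pos: "log_cap K > 0"
    and integrable_equilibrium_potential: "integrable (equilibrium_measure K) (\<lambda>w. ln (cmod (z - w)))"
    and equilibrium_measure_singleton: "emeasure (equilibrium_measure K) {z} = 0"
    and equilibrium_potential_ge: "ln (log_cap K) \<le> (\<integral>w. ln (cmod (z - w)) \<partial>equilibrium_measure K)"
proof -
  obtain R where R: "R > 0" "\<And>z. z \<in> K \<Longrightarrow> cmod z \<le> R"
    using compact_imp_bounded[OF K] by (auto simp: bounded_pos)
  define D where "D = 2 * R"
  have D: "D > 0" "\<And>z. z \<in> K \<Longrightarrow> cmod z \<le> D / 2" using R by (auto simp: D_def)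
  note le = log_energy_eq[OF _ compact_imp_closed[OF K] D(2,1)]
  obtain \<nu> where \<nu>: "prob_on K \<nu>" "log_energy \<nu> \<noteq> -\<infinity>" using np by (auto simp: polar_def)
  then have "mutual_energy D \<nu> \<nu> < \<infinity>" using le[OF \<nu>(1)] by (auto simp: less_top split: if_splits)
  then obtain \<mu> where \<mu>: "energy_minimiser D K \<mu>"
    using energy_minimiser_exists[OF K D(1) \<nu>(1)] by blast
  have p: "prob_on K \<mu>" and fin: "mutual_energy D \<mu> \<mu> < \<infinity>"
    and min: "\<And>\<nu>. prob_on K \<nu> \<Longrightarrow> mutual_energy D \<mu> \<mu> \<le> mutual_energy D \<nu> \<nu>"
    using \<mu> by (auto simp: energy_minimiser_def)
  define V where "V = ln D - enn2real (mutual_energy D \<mu> \<mu>)"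
  have V: "log_energy \<mu> = ereal V" using le[OF p] fin by (simp add: V_def)
  have sup: "energy_sup K = ereal V"
    unfolding energy_sup_def
  proof (rule SUP_eqI)
    show "log_energy \<rho> \<le> ereal V" if "\<rho> \<in> {\<mu>. prob_on K \<mu>}" for \<rho>
    proof (cases "mutual_energy D \<rho> \<rho> = \<infinity>")
      case False
      then have "enn2real (mutual_energy D \<mu> \<mu>) \<le> enn2real (mutual_energy D \<rho> \<rho>)"
        using min[of \<rho>] that by (intro enn2real_mono) (auto simp: less_top)
      then show ?thesis using le[of \<rho>] that False by (simp add: V_def)
    qed (use le[of \<rho>] that in simp)
    show "ereal V \<le> y" if "\<And>\<rho>. \<rho> \<in> {\<mu>. prob_on K \<mu>} \<Longrightarrow> log_energy \<rho> \<le> y" for y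
      using that[of \<mu>] p V by simp
  qed
  have "equilibrium_measure K = \<mu>"
    unfolding equilibrium_measure_def
  proof (rule the_equality)
    show "prob_on K \<mu> \<and> log_energy \<mu> = energy_sup K" using p V sup by simp
    fix \<rho> assume \<rho>: "prob_on K \<rho> \<and> log_energy \<rho> = energy_sup K"
    then have f: "mutual_energy D \<rho> \<rho> \<noteq> \<infinity>"
      and "enn2real (mutual_energy D \<rho> \<rho>) = enn2real (mutual_energy D \<mu> \<mu>)"
      using le[of \<rho>] sup by (auto simp: V_def split: if_splits)
    then have "mutual_energy D \<rho> \<rho> = mutual_energy D \<mu> \<mu>"
      using fin by (metis ennreal_enn2real infinity_ennreal_def top.not_eq_extremum)
    then have "energy_minimiser D K \<rho>" using \<rho> \<mu> by (simp add: energy_minimiser_def)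
    then show "\<rho> = \<mu>" using energy_minimiser_unique[OF K D _ \<mu>] by blast
  qed
  note eq = this
  have cap: "log_cap K = exp V" by (simp add: log_cap_def sup)
  show "prob_on K (equilibrium_measure K)" "log_cap K > 0"
    "integrable (equilibrium_measure K) (\<lambda>w. ln (cmod (z - w)))"
    "emeasure (equilibrium_measure K) {z} = 0"
    "ln (log_cap K) \<le> (\<integral>w. ln (cmod (z - w)) \<partial>equilibrium_measure K)"
    using p cap frostman_potential_ge[OF K D \<mu>, of z] by (auto simp: eq V_def)
qed

section \<open>Polynomials in several variables\<close>

text \<open>Each linear factor contributes the potential at its root, which is at least c wherever
  the root lies. Because \<open>ln 0 = 0\<close>, the logarithm of the product is split only off the
  roots, so almost sure nonvanishing is carried through the induction.\<close>

lemma integral_ln_poly_ge: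
  fixes p :: "complex poly" and \<mu> :: "complex measure" and c :: real
  assumes ps: "prob_space \<mu>" and sets: "sets \<mu> = sets borel"
    and int: "\<And>z. integrable \<mu> (\<lambda>w. ln (cmod (z - w)))"
    and ne: "\<And>z. AE w in \<mu>. w \<noteq> z"
    and c: "\<And>z. c \<le> (\<integral>w. ln (cmod (z - w)) \<partial>\<mu>)"
    and p: "p \<noteq> 0"
  shows "integrable \<mu> (\<lambda>w. ln (cmod (poly p w))) \<and> (AE w in \<mu>. poly p w \<noteq> 0) \<and>
      ln (cmod (lead_coeff p)) + degree p * c \<le> (\<integral>w. ln (cmod (poly p w)) \<partial>\<mu>)"
  using p
proof (induction "degree p" arbitrary: p)
  case 0
  interpret prob_space \<mu> by fact
  obtain b where "p = [:b:]" using 0 degree_eq_zeroE[of p] by auto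
  then show ?case using 0 by (simp add: prob_space)
next
  case (Suc n)
  obtain r where "poly p r = 0"
    using Suc fundamental_theorem_of_algebra[of p] by (auto simp: constant_degree)
  then obtain q where q: "p = [:- r, 1:] * q" by (auto simp: poly_eq_0_iff_dvd)
  have q0: "q \<noteq> 0" using q Suc.prems by auto
  have dq: "degree p = Suc (degree q)" using q q0 by (simp add: degree_mult_eq del: mult_pCons_left)
  have lc: "lead_coeff p = lead_coeff q" using q by (simp add: lead_coeff_mult del: mult_pCons_left)
  from Suc.hyps(1)[of q] Suc.hyps(2) dq q0 have IH: "integrable \<mu> (\<lambda>w. ln (cmod (poly q w)))"
    "AE w in \<mu>. poly q w \<noteq> 0"
    "ln (cmod (lead_coeff q)) + degree q * c \<le> (\<integral>w. ln (cmod (poly q w)) \<partial>\<mu>)" by auto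
  have pq: "poly p w = (w - r) * poly q w" for w by (simp add: q algebra_simps)
  have nz: "AE w in \<mu>. poly p w \<noteq> 0"
    using IH(2) ne[of r] by eventually_elim (simp add: pq)
  have eq: "AE w in \<mu>. ln (cmod (r - w)) + ln (cmod (poly q w)) = ln (cmod (poly p w))"
    using nz by eventually_elim (auto simp: pq norm_mult ln_mult norm_minus_commute)
  have i: "integrable \<mu> (\<lambda>w. ln (cmod (r - w)) + ln (cmod (poly q w)))" using IH(1) int by simp
  have "(\<lambda>w. poly p w) \<in> borel_measurable borel"
    by (intro borel_measurable_continuous_onI continuous_intros)
  then have m: "(\<lambda>w. ln (cmod (poly p w))) \<in> borel_measurable \<mu>"
    unfolding measurable_cong_sets[OF sets refl] by measurable
  have "integrable \<mu> (\<lambda>w. ln (cmod (poly p w)))"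
    by (rule integrable_cong_AE_imp[OF i m eq])
  moreover have "(\<integral>w. ln (cmod (poly p w)) \<partial>\<mu>) = (\<integral>w. ln (cmod (r - w)) + ln (cmod (poly q w)) \<partial>\<mu>)"
    using eq by (intro integral_cong_AE m borel_measurable_integrable[OF i]) (auto elim: eventually_mono)
  moreover have "\<dots> = (\<integral>w. ln (cmod (r - w)) \<partial>\<mu>) + (\<integral>w. ln (cmod (poly q w)) \<partial>\<mu>)"
    using IH(1) int by simp
  ultimately show ?case using nz IH(3) c[of r] lc dq by (simp add: algebra_simps)
qed

lemma mpoly_idx_Suc:
  "mpoly_idx (Suc n) m = (\<lambda>(i, k). k(n := i)) ` ({..m n} \<times> mpoly_idx n m)"
  unfolding mpoly_idx_def lessThan_Suc by (rule PiE_insert_eq)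

lemma mpoly_eval_Suc:
  "mpoly_eval (Suc n) m a (z(n := w)) = (\<Sum>i\<le>m n. mpoly_eval n m (\<lambda>k. a (k(n := i))) z * w ^ i)"
proof -
  have inj: "inj_on (\<lambda>(i, k). k(n := i)) ({..m n} \<times> mpoly_idx n m)"
    unfolding mpoly_idx_def by (rule inj_combinator) simp
  have "mpoly_eval (Suc n) m a (z(n := w)) =
     (\<Sum>(i, k)\<in>{..m n} \<times> mpoly_idx n m. of_int (a (k(n := i))) * (\<Prod>j<Suc n. (z(n := w)) j ^ (k(n := i)) j))"
    unfolding mpoly_eval_def mpoly_idx_Suc
    by (subst sum.reindex[OF inj]) (simp add: case_prod_unfold)
  also have "\<dots> = (\<Sum>(i, k)\<in>{..m n} \<times> mpoly_idx n m. (of_int (a (k(n := i))) * (\<Prod>j<n. z j ^ k j)) * w ^ i)"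
  proof (intro sum.cong refl, clarify)
    fix i k
    have "(\<Prod>j<n. (z(n := w)) j ^ (k(n := i)) j) = (\<Prod>j<n. z j ^ k j)" by (intro prod.cong) auto
    then show "of_int (a (k(n := i))) * (\<Prod>j<Suc n. (z(n := w)) j ^ (k(n := i)) j) =
        of_int (a (k(n := i))) * (\<Prod>j<n. z j ^ k j) * w ^ i" by simp
  qed
  also have "\<dots> = (\<Sum>i\<le>m n. mpoly_eval n m (\<lambda>k. a (k(n := i))) z * w ^ i)"
    unfolding mpoly_eval_def by (simp add: sum.cartesian_product[symmetric] sum_distrib_right)
  finally show ?thesis .
qed

lemma norm_mpoly_eval_le:
  assumes "\<And>j. j < n \<Longrightarrow> cmod (z j) \<le> R"
  shows "cmod (mpoly_eval n m a z) \<le> (\<Sum>k\<in>mpoly_idx n m. \<bar>real_of_int (a k)\<bar> * (\<Prod>j<n. R ^ k j))"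
  unfolding mpoly_eval_def
proof (rule sum_norm_le)
  fix k
  have "cmod (\<Prod>j<n. z j ^ k j) \<le> (\<Prod>j<n. R ^ k j)"
    unfolding prod_norm[symmetric] norm_power using assms by (intro prod_mono) (auto intro: power_mono)
  then show "cmod (of_int (a k) * (\<Prod>j<n. z j ^ k j)) \<le> \<bar>real_of_int (a k)\<bar> * (\<Prod>j<n. R ^ k j)"
    by (simp add: norm_mult mult_left_mono)
qed

lemma measurable_mpoly_eval:
  assumes "\<And>j. sets (M j) = sets (borel :: complex measure)"
  shows "mpoly_eval n m a \<in> borel_measurable (PiM {..<n} M)"
proof -
  have c: "(\<lambda>z. z j) \<in> borel_measurable (PiM {..<n} M)" if "j < n" for j
    using measurable_component_singleton[of j "{..<n}" M] that assms
      measurable_cong_sets[OF refl assms, of "PiM {..<n} M" j] by simp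
  show ?thesis unfolding mpoly_eval_def[abs_def]
    by (intro borel_measurable_sum borel_measurable_times borel_measurable_prod borel_measurable_power
        borel_measurable_const c) auto
qed

text \<open>Swaps the factors of \<open>distr_pair_PiM_eq_PiM\<close>, so that the last variable is
  integrated with the others held fixed.\<close>

lemma distr_PiM_Suc:
  assumes ps: "\<And>j. prob_space (M j)"
  shows "distr (PiM {..<n} M \<Otimes>\<^sub>M M n) (PiM {..<Suc n} M) (\<lambda>(X, x). X(n := x)) = PiM {..<Suc n} M"
proof -
  interpret P: prob_space "PiM {..<n} M" by (intro prob_space_PiM ps)
  interpret Mn: prob_space "M n" by fact
  interpret pair_sigma_finite "M n" "PiM {..<n} M" ..
  have "PiM {..<Suc n} M = distr (M n \<Otimes>\<^sub>M PiM {..<n} M) (PiM {..<Suc n} M) (\<lambda>(x, X). X(n := x))"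
    using distr_pair_PiM_eq_PiM[of "{..<n}" M n] ps by (simp add: lessThan_Suc)
  also have "\<dots> = distr (PiM {..<n} M \<Otimes>\<^sub>M M n) (PiM {..<Suc n} M) ((\<lambda>(x, X). X(n := x)) \<circ> (\<lambda>(x, y). (y, x)))"
    by (subst distr_pair_swap, subst distr_distr) (auto simp: lessThan_Suc)
  also have "((\<lambda>(x, X). X(n := x)) \<circ> (\<lambda>(x, y). (y, x))) = (\<lambda>(X, x). X(n := x))" by auto
  finally show ?thesis by simp
qed

text \<open>Absorbs an actual degree d below the nominal m: for c \<ge> 0 the minimum is 0, and for
  c < 0 the smaller multiple is the larger number.\<close>

lemma min_0_mult_le:
  fixes d m :: nat and c :: real
  assumes "d \<le> m"
  shows "min 0 (m * c) \<le> d * c"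
proof (cases "c \<ge> 0")
  case False
  then have "m * c \<le> d * c" using assms by (intro mult_right_mono_neg) auto
  then show ?thesis by simp
qed simp

text \<open>The coefficients vary in the induction, because the hypothesis is applied to the leading
  coefficient in the last variable. Integrability is proved along with the bound, since a
  non-integrable function would have integral 0 by convention.\<close>

lemma integral_ln_mpoly_ge:
  fixes M :: "nat \<Rightarrow> complex measure" and c :: "nat \<Rightarrow> real" and R :: real
  assumes ps: "\<And>j. prob_space (M j)" and sets: "\<And>j. sets (M j) = sets borel"
    and bd: "\<And>j. j < n \<Longrightarrow> AE w in M j. cmod w \<le> R"
    and int: "\<And>j z. j < n \<Longrightarrow> integrable (M j) (\<lambda>w. ln (cmod (z - w)))"
    and ne: "\<And>j z. j < n \<Longrightarrow> AE w in M j. w \<noteq> z"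
    and c: "\<And>j z. j < n \<Longrightarrow> c j \<le> (\<integral>w. ln (cmod (z - w)) \<partial>M j)"
    and nz: "\<exists>k\<in>mpoly_idx n m. a k \<noteq> 0"
  shows "integrable (PiM {..<n} M) (\<lambda>z. ln (cmod (mpoly_eval n m a z))) \<and>
     (AE z in PiM {..<n} M. mpoly_eval n m a z \<noteq> 0) \<and>
     (\<Sum>j<n. min 0 (m j * c j)) \<le> (\<integral>z. ln (cmod (mpoly_eval n m a z)) \<partial>PiM {..<n} M)"
  using bd int ne c nz
proof (induction n arbitrary: a)
  case 0
  interpret prob_space "PiM {} M" by (intro prob_space_PiM ps)
  \<comment> \<open>Without variables the only index is \<open>\<lambda>_. undefined\<close> and the
    polynomial is a nonzero integer, so its logarithm is at least 0. This is where integrality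
    enters.\<close>
  have "\<bar>real_of_int (a (\<lambda>_. undefined))\<bar> \<ge> 1" "a (\<lambda>_. undefined) \<noteq> 0"
    using 0(5) by (auto simp: mpoly_idx_def)
  then show ?case
    using prob_space by (simp add: mpoly_eval_def mpoly_idx_def)
next
  case (Suc n)
  let ?P = "PiM {..<n} M" and ?F = "mpoly_eval (Suc n) m a"
  interpret P: prob_space ?P by (intro prob_space_PiM ps)
  interpret Mn: prob_space "M n" by (rule ps)
  interpret pair_sigma_finite ?P "M n" ..
  \<comment> \<open>The powers of the last variable that really occur; \<open>m n\<close> is only an
    upper bound for the largest one, d.\<close>
  define N where "N = {i. i \<le> m n \<and> (\<exists>k\<in>mpoly_idx n m. a (k(n := i)) \<noteq> 0)}"
  have fN: "finite N" by (simp add: N_def)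
  have neN: "N \<noteq> {}" using Suc.prems(5) by (auto simp: N_def mpoly_idx_Suc)
  define d where "d = Max N"
  have "d \<in> N" using Max_in[OF fN neN] by (simp add: d_def)
  then have d: "d \<le> m n" "\<exists>k\<in>mpoly_idx n m. a (k(n := d)) \<noteq> 0" by (auto simp: N_def)
  have above: "a (k(n := i)) = 0" if "i > d" "i \<le> m n" "k \<in> mpoly_idx n m" for i k
  proof (rule ccontr)
    assume "a (k(n := i)) \<noteq> 0"
    then have "i \<in> N" using that by (auto simp: N_def)
    then show False using Max_ge[OF fN] that(1) by (auto simp: d_def dest: leD)
  qed
  define q where "q i = mpoly_eval n m (\<lambda>k. a (k(n := i)))" for i
  have q0: "q i z = 0" if "i > d" "i \<le> m n" for i z
    unfolding q_def mpoly_eval_def using above[OF that] by (intro sum.neutral) auto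
  have F: "?F (z(n := w)) = (\<Sum>i\<le>d. q i z * w ^ i)" for z w
    unfolding mpoly_eval_Suc q_def[symmetric] using d(1) q0 by (intro sum.mono_neutral_right) auto
  define p where "p z = (\<Sum>i\<le>d. monom (q i z) i)" for z
  have p: "poly (p z) w = ?F (z(n := w))" for z w
    by (simp add: p_def F poly_sum poly_monom)
  have cp: "coeff (p z) i = (if i \<le> d then q i z else 0)" for z i
    by (simp add: p_def coeff_sum)
  have dp: "degree (p z) = d" if "q d z \<noteq> 0" for z
    by (rule antisym[OF degree_le le_degree]) (use that in \<open>auto simp: cp\<close>)
  have "integrable ?P (\<lambda>z. ln (cmod (q d z))) \<and> (AE z in ?P. q d z \<noteq> 0) \<and>
     (\<Sum>j<n. min 0 (m j * c j)) \<le> (\<integral>z. ln (cmod (q d z)) \<partial>?P)"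
    unfolding q_def
    by (rule Suc.IH[OF Suc.prems(1)[OF less_SucI] Suc.prems(2)[OF less_SucI]
          Suc.prems(3)[OF less_SucI] Suc.prems(4)[OF less_SucI] d(2)])
  then have Q: "integrable ?P (\<lambda>z. ln (cmod (q d z)))" "AE z in ?P. q d z \<noteq> 0"
     "(\<Sum>j<n. min 0 (m j * c j)) \<le> (\<integral>z. ln (cmod (q d z)) \<partial>?P)" by auto
  have inner: "integrable (M n) (\<lambda>w. ln (cmod (?F (z(n := w))))) \<and> (AE w in M n. ?F (z(n := w)) \<noteq> 0) \<and>
      ln (cmod (q d z)) + d * c n \<le> (\<integral>w. ln (cmod (?F (z(n := w)))) \<partial>M n)" if "q d z \<noteq> 0" for z
  proof -
    have "p z \<noteq> 0" using cp[of z d] that by auto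
    then show ?thesis
      using integral_ln_poly_ge[OF ps sets Suc.prems(2,3,4), of n "p z"] dp[OF that] cp[of z d]
      by (simp add: p)
  qed
  have F_meas[measurable]: "?F \<in> borel_measurable (PiM {..<Suc n} M)" by (rule measurable_mpoly_eval[OF sets])
  have upd[measurable]: "(\<lambda>(X, x). X(n := x)) \<in> ?P \<Otimes>\<^sub>M M n \<rightarrow>\<^sub>M PiM {..<Suc n} M"
    by (simp add: lessThan_Suc)
  have G_meas[measurable]: "(\<lambda>p. ?F ((fst p)(n := snd p))) \<in> borel_measurable (?P \<Otimes>\<^sub>M M n)"
    using measurable_compose[OF upd F_meas] by (simp add: case_prod_unfold)
  define B where "B = (\<Sum>k\<in>mpoly_idx (Suc n) m. \<bar>real_of_int (a k)\<bar> * (\<Prod>j<Suc n. R ^ k j))"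
  \<comment> \<open>The maximum with 0 covers the zeros of the polynomial, where
    \<open>ln 0 = 0\<close>, and makes |g| \<le> 2 C - g valid for every g \<le> C.\<close>
  define C where "C = max 0 (ln B)"
  have bound: "AE z in PiM {..<Suc n} M. ln (cmod (?F z)) \<le> C"
  proof -
    have "AE z in PiM {..<Suc n} M. \<forall>j\<in>{..<Suc n}. cmod (z j) \<le> R"
      using Suc.prems(1) by (intro AE_finite_allI AE_PiM_component ps) auto
    then show ?thesis
    proof eventually_elim
      case (elim z)
      have "cmod (?F z) \<le> B" unfolding B_def by (rule norm_mpoly_eval_le) (use elim in auto)
      then show ?case
        by (cases "?F z = 0") (auto simp: C_def intro!: max.coboundedI2 ln_mono)
    qed
  qed
  have D: "PiM {..<Suc n} M = distr (?P \<Otimes>\<^sub>M M n) (PiM {..<Suc n} M) (\<lambda>(X, x). X(n := x))"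
    by (rule distr_PiM_Suc[of M, OF ps, symmetric])
  have "AE p in ?P \<Otimes>\<^sub>M M n. ln (cmod (?F ((fst p)(n := snd p)))) \<le> C"
    using AE_distrD[OF upd, of "\<lambda>z. ln (cmod (?F z)) \<le> C", unfolded D[symmetric], OF bound]
    by (simp add: case_prod_unfold)
  from AE_pair[OF this] have bound': "AE z in ?P. AE w in M n. ln (cmod (?F (z(n := w)))) \<le> C" by simp
  let ?G = "\<lambda>p. ln (cmod (?F ((fst p)(n := snd p))))"
  have intG: "integrable (?P \<Otimes>\<^sub>M M n) ?G"
  proof (rule Fubini_integrable)
    show "integrable ?P (\<lambda>z. \<integral>w. norm (?G (z, w)) \<partial>M n)"
    proof (rule Bochner_Integration.integrable_bound)
      \<comment> \<open>The inequality |?G| \<le> 2 C - ?G turns the lower bound for the inner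
        integral of ?G into an upper bound for that of |?G|, integrable by the induction
        hypothesis.\<close>
      show "integrable ?P (\<lambda>z. 2 * C - ln (cmod (q d z)) - d * c n)" using Q(1) by simp
      show "(\<lambda>z. \<integral>w. norm (?G (z, w)) \<partial>M n) \<in> borel_measurable ?P" by measurable
      show "AE z in ?P. norm (\<integral>w. norm (?G (z, w)) \<partial>M n) \<le> norm (2 * C - ln (cmod (q d z)) - d * c n)"
        using bound' Q(2)
      proof eventually_elim
        case (elim z)
        note i = inner[OF elim(2)]
        have "(\<integral>w. norm (?G (z, w)) \<partial>M n) \<le> (\<integral>w. 2 * C - ?G (z, w) \<partial>M n)"
        proof (rule integral_mono_AE)
          show "AE w in M n. norm (?G (z, w)) \<le> 2 * C - ?G (z, w)"
            using elim(1) by eventually_elim (auto simp: C_def)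
        qed (use i in auto)
        also have "\<dots> = 2 * C - (\<integral>w. ?G (z, w) \<partial>M n)" using i by (simp add: Mn.prob_space)
        also have "\<dots> \<le> 2 * C - ln (cmod (q d z)) - d * c n" using i by simp
        finally show ?case by (simp add: abs_of_nonneg[OF Bochner_Integration.integral_nonneg])
      qed
    qed
    show "AE z in ?P. integrable (M n) (\<lambda>w. ?G (z, w))"
      using Q(2) by eventually_elim (use inner in simp)
  qed measurable
  have "(\<Sum>j<Suc n. min 0 (m j * c j)) \<le> (\<integral>z. ln (cmod (q d z)) \<partial>?P) + d * c n"
    using Q(3) min_0_mult_le[OF d(1), of "c n"] by simp
  also have "\<dots> = (\<integral>z. ln (cmod (q d z)) + d * c n \<partial>?P)" using Q(1) by (simp add: P.prob_space)
  also have "\<dots> \<le> (\<integral>z. (\<integral>w. ?G (z, w) \<partial>M n) \<partial>?P)"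
  proof (rule integral_mono_AE)
    show "integrable ?P (\<lambda>z. \<integral>w. ?G (z, w) \<partial>M n)" by (rule integrable_fst'[OF intG])
    show "AE z in ?P. ln (cmod (q d z)) + d * c n \<le> (\<integral>w. ?G (z, w) \<partial>M n)"
      using Q(2) by eventually_elim (use inner in simp)
  qed (use Q(1) in simp)
  also have "\<dots> = (\<integral>p. ?G p \<partial>(?P \<Otimes>\<^sub>M M n))" by (rule integral_fst'[OF intG])
  also have "\<dots> = (\<integral>z. ln (cmod (?F z)) \<partial>PiM {..<Suc n} M)"
    by (subst D, subst integral_distr[OF upd]) (auto simp: case_prod_unfold)
  finally have 3: "(\<Sum>j<Suc n. min 0 (m j * c j)) \<le> (\<integral>z. ln (cmod (?F z)) \<partial>PiM {..<Suc n} M)" .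
  have 1: "integrable (PiM {..<Suc n} M) (\<lambda>z. ln (cmod (?F z)))"
    using intG by (subst D, subst integrable_distr_eq[OF upd]) (auto simp: case_prod_unfold)
  have 2: "AE z in PiM {..<Suc n} M. ?F z \<noteq> 0"
  proof -
    have "AE p in ?P \<Otimes>\<^sub>M M n. ?F ((fst p)(n := snd p)) \<noteq> 0"
    proof (rule AE_pair_measure)
      show "{p \<in> space (?P \<Otimes>\<^sub>M M n). ?F ((fst p)(n := snd p)) \<noteq> 0} \<in> sets (?P \<Otimes>\<^sub>M M n)" by measurable
      show "AE z in ?P. AE w in M n. ?F ((fst (z, w))(n := snd (z, w))) \<noteq> 0"
        using Q(2) by eventually_elim (use inner in simp)
    qed
    then show ?thesis
      by (subst D, subst AE_distr_iff[OF upd]) (auto simp: case_prod_unfold)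
  qed
  from 1 2 3 show ?case by simp
qed

theorem theorem5p3:
  fixes n :: nat and K :: "nat \<Rightarrow> complex set" and m :: "nat \<Rightarrow> nat"
    and a :: "(nat \<Rightarrow> nat) \<Rightarrow> int"
  assumes compactK: "\<And>j. j < n \<Longrightarrow> compact (K j)"
    and nonpolar: "\<And>j. j < n \<Longrightarrow> \<not> polar (K j)"
    and nonzero: "\<exists>k\<in>mpoly_idx n m. a k \<noteq> 0"
    and degree: "\<And>j. j < n \<Longrightarrow> \<exists>k\<in>mpoly_idx n m. a k \<noteq> 0 \<and> k j = m j"
  shows "integrable (product_eq_measure n K) (\<lambda>z. ln (cmod (mpoly_eval n m a z)))
         \<and> mahler_measure n K m a \<ge> (\<Prod>j<n. min 1 (log_cap (K j) ^ m j))"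
proof -
  \<comment> \<open>\<open>integral_ln_mpoly_ge\<close> asks for a probability measure at every
    index, so indices from n on receive a point mass, which the product over \<open>{..<n}\<close>
    does not see.\<close>
  define M where "M j = (if j < n then equilibrium_measure (K j) else return borel 0)" for j
  have Meq: "product_eq_measure n K = PiM {..<n} M"
    unfolding product_eq_measure_def by (intro PiM_cong) (auto simp: M_def)
  note eq = equilibrium_measure_properties[OF compactK nonpolar]
  have ps: "prob_space (M j)" and sets: "sets (M j) = sets borel" for j
    using eq(1)[of j] by (auto simp: M_def prob_on_def prob_space_return)
  have "compact (\<Union>j<n. K j)" using compactK by (intro compact_UN) auto
  then obtain R where "\<forall>z\<in>\<Union>j<n. K j. cmod z \<le> R"
    using compact_imp_bounded bounded_iff by metis
  then have R: "\<And>j z. j < n \<Longrightarrow> z \<in> K j \<Longrightarrow> cmod z \<le> R" by auto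
  have main: "integrable (PiM {..<n} M) (\<lambda>z. ln (cmod (mpoly_eval n m a z))) \<and>
     (AE z in PiM {..<n} M. mpoly_eval n m a z \<noteq> 0) \<and>
     (\<Sum>j<n. min 0 (m j * ln (log_cap (K j)))) \<le> (\<integral>z. ln (cmod (mpoly_eval n m a z)) \<partial>PiM {..<n} M)"
  proof (rule integral_ln_mpoly_ge[OF ps sets])
    fix j z assume j: "j < n"
    then have Mj: "M j = equilibrium_measure (K j)" by (simp add: M_def)
    show "AE w in M j. cmod w \<le> R"
      unfolding Mj using prob_on_AE[OF eq(1)[OF j j] compact_imp_closed[OF compactK[OF j]]]
      by eventually_elim (rule R[OF j])
    show "integrable (M j) (\<lambda>w. ln (cmod (z - w)))" unfolding Mj by (rule eq(3)[OF j j])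
    show "ln (log_cap (K j)) \<le> (\<integral>w. ln (cmod (z - w)) \<partial>M j)" unfolding Mj by (rule eq(5)[OF j j])
    show "AE w in M j. w \<noteq> z"
      using eq(4)[OF j j, of z] sets[of j] by (intro AE_I[where N="{z}"]) (auto simp: Mj)
  qed (rule nonzero)
  have "(\<Prod>j<n. min 1 (log_cap (K j) ^ m j)) = (\<Prod>j<n. exp (min 0 (m j * ln (log_cap (K j)))))"
  proof (intro prod.cong refl)
    fix j assume "j \<in> {..<n}"
    then have "log_cap (K j) > 0" using eq(2) by simp
    then have "log_cap (K j) ^ m j = exp (m j * ln (log_cap (K j)))" by (simp add: exp_of_nat_mult)
    then show "min 1 (log_cap (K j) ^ m j) = exp (min 0 (m j * ln (log_cap (K j))))"
      by (auto simp: min_def)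
  qed
  also have "\<dots> = exp (\<Sum>j<n. min 0 (m j * ln (log_cap (K j))))" by (simp add: exp_sum)
  also have "\<dots> \<le> mahler_measure n K m a" using main by (simp add: mahler_measure_def Meq)
  finally show ?thesis using main by (simp add: Meq)
qed

end
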